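(* Let $\{P_t\}_{t\geq 0}$ be a Markov--Feller semigroup on a Polish space $\mathcal{X}$. The following are equivalent: (i) $\{P_t\}_{t\geq 0}$ is asymptotically stable (with unique invariant measure $\mu$); (ii) $\{P_t\}_{t\geq 0}$ is eventually continuous at every point of $\mathcal{X}$, and there exists $z\in\mathcal{X}$ such that for every $\epsilon>0$, $\inf_{x\in\mathcal{X}}\liminf_{t\to\infty}P_t(x,B(z,\epsilon))>0$; (iii) there exists $z\in\mathcal{X}$ such that $\{P_t\}_{t\geq 0}$ is eventually continuous at $z$ and for every $\epsilon>0$, $\inf_{x\in\mathcal{X}}\liminf_{t\to\infty}P_t(x,B(z,\epsilon))>0$.
   Context: $(\mathcal{X},\rho)$ is a Polish space, $B(z,\epsilon)$ the open ball, $\mathcal{P}(\mathcal{X})$ the Borel probability measures. A Markov--Feller semigroup $\{P_t\}_{t\ge0}$ is a semigroup of mass-preserving positively linear operators on finite Borel measures, each with a dual linear operator on bounded Borel functions ($\langle f,P_t\mu\rangle=\langle P_tf,\mu\rangle$) preserving bounded continuous functions; $P_t(x,A):=(P_t\delta_x)(A)$. Asymptotically stable: there is a unique invariant probability measure $\mu_*$ and $P_t\mu\to\mu_*$ weakly as $t\to\infty$ for every $\mu\in\mathcal{P}(\mathcal{X})$. Eventually continuous at $z$: for every bounded Lipschitz $f$, $\limsup_{x\to z}\limsup_{t\to\infty}|P_tf(x)-P_tf(z)|=0$. *)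

theory Defs
  imports "HOL-Analysis.Analysis" "HOL-Probability.Probability"
begin

(* A Markov--Feller semigroup on a Polish space 'a, given by its transition
  kernels: K t x is the measure P_t delta_x = P_t(x, .), for t \<ge> 0.
  The action on a probability measure mu is P_t mu = mu \<bind> K t, and the
  dual action on a bounded Borel function f is P_t f (x) = integral of f w.r.t. K t x. *)

definition markov_feller_semigroup :: "(real \<Rightarrow> 'a::polish_space \<Rightarrow> 'a measure) \<Rightarrow> bool" where
  "markov_feller_semigroup K \<longleftrightarrow>
     (\<forall>t\<ge>0. K t \<in> borel \<rightarrow>\<^sub>M prob_algebra borel) \<and>
     (\<forall>x. K 0 x = return borel x) \<and>
     (\<forall>s\<ge>0. \<forall>t\<ge>0. \<forall>x. K (s + t) x = K s x \<bind> K t) \<and>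
     (\<forall>t\<ge>0. \<forall>f::'a \<Rightarrow> real. continuous_on UNIV f \<and> bounded (range f) \<longrightarrow>
        continuous_on UNIV (\<lambda>x. \<integral>y. f y \<partial>K t x))"

definition weak_conv_at_top :: "(real \<Rightarrow> 'a::polish_space measure) \<Rightarrow> 'a measure \<Rightarrow> bool" where
  "weak_conv_at_top M N \<longleftrightarrow>
     (\<forall>f::'a \<Rightarrow> real. continuous_on UNIV f \<and> bounded (range f) \<longrightarrow>
        ((\<lambda>t. \<integral>y. f y \<partial>M t) \<longlongrightarrow> (\<integral>y. f y \<partial>N)) at_top)"

definition invariant_measure :: "(real \<Rightarrow> 'a::polish_space \<Rightarrow> 'a measure) \<Rightarrow> 'a measure \<Rightarrow> bool" where
  "invariant_measure K \<mu> \<longleftrightarrow> \<mu> \<in> space (prob_algebra borel) \<and> (\<forall>t\<ge>0. \<mu> \<bind> K t = \<mu>)"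

definition asymptotically_stable :: "(real \<Rightarrow> 'a::polish_space \<Rightarrow> 'a measure) \<Rightarrow> bool" where
  "asymptotically_stable K \<longleftrightarrow>
     (\<exists>\<mu>. (\<forall>\<nu>. invariant_measure K \<nu> \<longleftrightarrow> \<nu> = \<mu>) \<and>
          (\<forall>\<nu>\<in>space (prob_algebra borel). weak_conv_at_top (\<lambda>t. \<nu> \<bind> K t) \<mu>))"

(* Eventual continuity at z: for every bounded Lipschitz f,
  limsup_{x\<rightarrow>z} limsup_{t\<rightarrow>\<infinity>} |P_t f x - P_t f z| = 0.
  The outer limsup is taken along nhds z (so it is well-defined also at isolated
  points; since the term at x = z is 0 this agrees with the punctured limsup
  at non-isolated points). *)
definition eventually_continuous_at :: "(real \<Rightarrow> 'a::polish_space \<Rightarrow> 'a measure) \<Rightarrow> 'a \<Rightarrow> bool" where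
  "eventually_continuous_at K z \<longleftrightarrow>
     (\<forall>f::'a \<Rightarrow> real. (\<exists>L. L-lipschitz_on UNIV f) \<and> bounded (range f) \<longrightarrow>
        Limsup (nhds z) (\<lambda>x. Limsup at_top
           (\<lambda>t. ereal \<bar>(\<integral>y. f y \<partial>K t x) - (\<integral>y. f y \<partial>K t z)\<bar>)) = 0)"

definition lower_bound_cond :: "(real \<Rightarrow> 'a::polish_space \<Rightarrow> 'a measure) \<Rightarrow> 'a \<Rightarrow> bool" where
  "lower_bound_cond K z \<longleftrightarrow>
     (\<forall>e>0. (INF x. Liminf at_top (\<lambda>t. ereal (measure (K t x) (ball z e)))) > 0)"

end

theory Submission
  imports Defs
begin

text \<open>For the hard direction, let \<open>d\<close> be the largest asymptotic discrepancy
  \<open>limsup |<f, P_t \<mu>> - <f, P_t \<nu>>|\<close> over all pairs of initial laws. At some common time both laws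
  have a fraction \<open>c\<close> of their mass near \<open>z\<close>, where eventual continuity makes the discrepancy at most
  \<open>2 \<eta>\<close>; hence \<open>d \<le> c (2 \<eta>) + (1 - c) d\<close>, so \<open>d \<le> 2 \<eta>\<close> for every \<open>\<eta>\<close>, and all orbits merge.
  It remains to find one invariant probability measure. The orbit of \<open>z\<close> turns out to be tight, any
  cluster point of it is represented by a measure through the Daniell construction (which replaces
  Prokhorov's theorem), and merging makes this measure invariant.\<close>

section \<open>Measures from Daniell functionals\<close>

text \<open>Both hypotheses leave the waiting time dependent on the starting point. Integrating over
  the starting law by dominated convergence removes this dependence. Discrepancies are taken over
  all pairs of laws and not only over point masses because the remainders left after splitting off
  mass near \<open>z\<close> are again arbitrary laws. The obstacle is tightness: merging concerns
  one fixed test function, whereas mass that leaves every compact set is seen by a new function at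
  each time. Bumps around uniformly separated sets overcome this, since any sum of them, even an
  infinite one, is again a single Lipschitz function to which merging applies. Knowing this for all
  subfamilies of bumps, a gliding hump as in Phillips' lemma controls the diagonal. Baire's theorem
  makes that control uniform on a relatively open piece of the closed set carrying the orbit of
  \<open>z\<close>, and the Feller property shows that the orbit keeps returning to that piece.
  Eventual continuity only tests Lipschitz functions, so weak convergence follows from merging by
  approximating continuous functions from below.\<close>

definition bcont :: "('a::topological_space \<Rightarrow> real) \<Rightarrow> bool" where
  "bcont f \<longleftrightarrow> continuous_on UNIV f \<and> bounded (range f)"

lemma bcontI: "continuous_on UNIV f \<Longrightarrow> (\<And>x. \<bar>f x\<bar> \<le> B) \<Longrightarrow> bcont f"
  unfolding bcont_def bounded_iff by auto

lemma bcont_continuous: "bcont f \<Longrightarrow> continuous_on S f"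
  unfolding bcont_def using continuous_on_subset by blast

lemma bcont_bound:
  assumes "bcont f"
  obtains B where "B > 0" "\<And>x. \<bar>f x\<bar> \<le> B"
  using assms unfolding bcont_def bounded_pos by auto

lemma bcont_measurable[measurable_dest]: "bcont f \<Longrightarrow> f \<in> borel_measurable borel"
  by (simp add: bcont_def borel_measurable_continuous_onI)

lemma bcont_const[simp, intro]: "bcont (\<lambda>_. c)"
  by (rule bcontI[where B = "\<bar>c\<bar>"]) auto

lemma bcont_add[intro]:
  assumes "bcont f" "bcont g" shows "bcont (\<lambda>x. f x + g x)"
proof -
  obtain B C where "\<And>x. \<bar>f x\<bar> \<le> B" "\<And>x. \<bar>g x\<bar> \<le> C"
    using assms bcont_bound by metis
  then have "\<bar>f x + g x\<bar> \<le> B + C" for x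
    by (meson abs_triangle_ineq add_mono order_trans)
  then show ?thesis
    using assms by (intro bcontI[where B = "B + C"]) (auto intro!: continuous_intros intro: bcont_continuous)
qed

lemma bcont_mult[intro]:
  assumes "bcont f" "bcont g" shows "bcont (\<lambda>x. f x * g x)"
proof -
  obtain B C where "B > 0" "\<And>x. \<bar>f x\<bar> \<le> B" "\<And>x. \<bar>g x\<bar> \<le> C"
    using assms bcont_bound by metis
  then have "\<bar>f x * g x\<bar> \<le> B * C" for x
    unfolding abs_mult by (intro mult_mono) auto
  then show ?thesis
    using assms by (intro bcontI[where B = "B * C"]) (auto intro!: continuous_intros intro: bcont_continuous)
qed

lemma bcont_diff[intro]: "bcont f \<Longrightarrow> bcont g \<Longrightarrow> bcont (\<lambda>x. f x - g x)"
  using bcont_add[of f "\<lambda>x. (-1) * g x"] bcont_mult[of "\<lambda>_. -1" g] by simp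

lemma bcont_sum[intro]: "(\<And>i. i \<in> I \<Longrightarrow> bcont (f i)) \<Longrightarrow> bcont (\<lambda>x. \<Sum>i\<in>I. f i x)"
  by (induction I rule: infinite_finite_induct) auto

lemma bcont_max[intro]:
  assumes "bcont f" "bcont g" shows "bcont (\<lambda>x. max (f x) (g x))"
proof -
  obtain B C where "\<And>x. \<bar>f x\<bar> \<le> B" "\<And>x. \<bar>g x\<bar> \<le> C"
    using assms bcont_bound by metis
  then have "\<bar>max (f x) (g x)\<bar> \<le> max B C" for x
    by (smt (verit) max_def)
  then show ?thesis
    using assms by (intro bcontI[where B = "max B C"]) (auto intro!: continuous_intros intro: bcont_continuous)
qed

lemma bcont_min[intro]:
  assumes "bcont f" "bcont g" shows "bcont (\<lambda>x. min (f x) (g x))"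
proof -
  have "min (f x) (g x) = f x + g x - max (f x) (g x)" for x by auto
  then show ?thesis using bcont_diff[OF bcont_add[OF assms] bcont_max[OF assms]] by simp
qed

lemma bcont_integrable:
  assumes "bcont f" "prob_space M" "sets M = sets borel"
  shows "integrable M f"
proof -
  interpret prob_space M by fact
  obtain B where "\<And>x. \<bar>f x\<bar> \<le> B" using assms bcont_bound by metis
  then show ?thesis
    using assms bcont_measurable[OF assms(1)]
    by (intro integrable_const_bound[where B = B]) (auto cong: measurable_cong_sets)
qed

text \<open>Continuous minorants increasing to the indicator of an open set. The case distinction is
  due to the convention \<open>infdist x {} = 0\<close>, under which the formula would vanish
  identically for \<open>U = UNIV\<close>.\<close>

definition open_bump :: "'a::metric_space set \<Rightarrow> nat \<Rightarrow> 'a \<Rightarrow> real" where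
  "open_bump U n x = (if U = UNIV then 1 else min 1 (real n * infdist x (- U)))"

lemma open_bump_nonneg: "open_bump U n x \<ge> 0"
  by (simp add: open_bump_def infdist_nonneg)

lemma open_bump_le_indicator: "open_bump U n x \<le> indicator U x"
  by (auto simp: open_bump_def indicator_def infdist_nonneg)

lemma bcont_open_bump: "bcont (open_bump U n)"
proof (cases "U = UNIV")
  case False
  then show ?thesis
    using open_bump_nonneg[of U n] open_bump_le_indicator[of U n]
    by (intro bcontI[where B = 1])
       (auto simp: open_bump_def[abs_def] indicator_def intro!: continuous_intros)
qed (auto simp: open_bump_def[abs_def])

lemma open_bump_mono: "m \<le> n \<Longrightarrow> open_bump U m x \<le> open_bump U n x"
  by (auto simp: open_bump_def infdist_nonneg mult_right_mono min.coboundedI2)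

lemma open_bump_tendsto:
  assumes "open U" "x \<in> U"
  shows "(\<lambda>n. open_bump U n x) \<longlonglongrightarrow> 1"
proof (cases "U = UNIV")
  case False
  have "infdist x (- U) > 0"
    using assms False by (intro infdist_pos_not_in_closed) auto
  then obtain N where "real N * infdist x (- U) > 1"
    using reals_Archimedean3 by blast
  then have "open_bump U n x = 1" if "n \<ge> N" for n
    using False that mult_right_mono[of "real N" "real n" "infdist x (- U)"]
    by (auto simp: open_bump_def infdist_nonneg)
  then show ?thesis
    by (intro tendsto_eventually eventually_sequentiallyI)
qed (auto simp: open_bump_def)

text \<open>Layer-cake slicing: the summand \<open>k\<close> is the part of \<open>y\<close> between
  the heights \<open>k\<close> and \<open>k + 1\<close>.\<close>

lemma sum_unit_slices:
  fixes y :: real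
  assumes "y \<ge> 0"
  shows "(\<Sum>k<m. min 1 (max 0 (y - real k))) = min (real m) y"
  using assms by (induction m) auto

section \<open>Riesz-type construction of a probability measure from a functional\<close>

locale daniell_functional =
  fixes \<Lambda> :: "('a::metric_space \<Rightarrow> real) \<Rightarrow> real"
  assumes add: "bcont f \<Longrightarrow> bcont g \<Longrightarrow> \<Lambda> (\<lambda>x. f x + g x) = \<Lambda> f + \<Lambda> g"
    and scale: "bcont f \<Longrightarrow> \<Lambda> (\<lambda>x. c * f x) = c * \<Lambda> f"
    and nonneg: "bcont f \<Longrightarrow> (\<And>x. f x \<ge> 0) \<Longrightarrow> \<Lambda> f \<ge> 0"
    and one: "\<Lambda> (\<lambda>_. 1) = 1"
    and decseq_tendsto_0:
      "(\<And>n. bcont (F n)) \<Longrightarrow> (\<And>x. decseq (\<lambda>n. F n x)) \<Longrightarrow> (\<And>x. (\<lambda>n. F n x) \<longlonglongrightarrow> 0)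
        \<Longrightarrow> (\<lambda>n. \<Lambda> (F n)) \<longlonglongrightarrow> 0"
begin

lemma diff: "bcont f \<Longrightarrow> bcont g \<Longrightarrow> \<Lambda> (\<lambda>x. f x - g x) = \<Lambda> f - \<Lambda> g"
  using add[of f "\<lambda>x. (-1) * g x"] scale[of g "-1"] bcont_mult[of "\<lambda>_. -1" g] by simp

lemma mono: "bcont f \<Longrightarrow> bcont g \<Longrightarrow> (\<And>x. f x \<le> g x) \<Longrightarrow> \<Lambda> f \<le> \<Lambda> g"
  using nonneg[of "\<lambda>x. g x - f x"] diff[of g f] by auto

lemma const: "\<Lambda> (\<lambda>_. c) = c"
  using scale[of "\<lambda>_. 1" c] one by simp

lemma sum: "(\<And>i. i \<in> I \<Longrightarrow> bcont (f i)) \<Longrightarrow> \<Lambda> (\<lambda>x. \<Sum>i\<in>I. f i x) = (\<Sum>i\<in>I. \<Lambda> (f i))"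
proof (induction I rule: infinite_finite_induct)
  case (insert i I)
  then show ?case using add[of "f i" "\<lambda>x. \<Sum>i\<in>I. f i x"] by auto
qed (auto simp: const)

definition below :: "'a set \<Rightarrow> ('a \<Rightarrow> real) set" where
  "below U = {f. bcont f \<and> (\<forall>x. 0 \<le> f x \<and> f x \<le> indicator U x)}"

text \<open>The content of an open set as in the Riesz representation theorem, with bounded
  continuous functions in place of compactly supported ones.\<close>

definition open_content :: "'a set \<Rightarrow> ennreal" where
  "open_content U = (SUP f\<in>below U. ennreal (\<Lambda> f))"

definition outer :: "'a set \<Rightarrow> ennreal" where
  "outer A = (INF U\<in>{U. open U \<and> A \<subseteq> U}. open_content U)"

lemma below_nonempty[simp]: "below U \<noteq> {}"
  by (auto simp: below_def intro!: exI[of _ "\<lambda>_. 0"])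

lemma open_content_upper: "f \<in> below U \<Longrightarrow> ennreal (\<Lambda> f) \<le> open_content U"
  unfolding open_content_def by (rule SUP_upper)

lemma open_content_mono: "U \<subseteq> V \<Longrightarrow> open_content U \<le> open_content V"
  unfolding open_content_def
proof (intro SUP_subset_mono order_refl subsetI)
  fix f assume UV: "U \<subseteq> V" and f: "f \<in> below U"
  have "indicator U x \<le> (indicator V x :: real)" for x
    using UV by (auto simp: indicator_def)
  then show "f \<in> below V"
    using f unfolding below_def by (auto intro: order_trans)
qed

lemma open_content_UNIV: "open_content UNIV = 1"
proof (rule antisym)
  show "open_content UNIV \<le> 1"
    unfolding open_content_def
    by (rule SUP_least) (use mono[of _ "\<lambda>_. 1"] in \<open>auto simp: below_def one\<close>)
  show "1 \<le> open_content UNIV"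
    using open_content_upper[of "\<lambda>_. 1" UNIV] by (auto simp: below_def one)
qed

lemma outer_open: "open U \<Longrightarrow> outer U = open_content U"
  unfolding outer_def by (intro antisym INF_lower INF_greatest open_content_mono) auto

lemma outer_mono: "A \<subseteq> B \<Longrightarrow> outer A \<le> outer B"
  unfolding outer_def by (rule INF_superset_mono) auto

text \<open>Where the Riesz theorem would take a finite subcover of a compact support, continuity of
  \<open>\<Lambda>\<close> along decreasing sequences is used: a function below the union is
  dominated by bumps in the first sets plus a remainder that decreases to 0 pointwise.\<close>

lemma open_content_UN_le:
  fixes U :: "nat \<Rightarrow> 'a set"
  assumes op: "\<And>i. open (U i)"
  shows "open_content (\<Union>i. U i) \<le> (\<Sum>i. open_content (U i))"
  unfolding open_content_def[of "\<Union>i. U i"]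
proof (rule SUP_least)
  fix f assume f: "f \<in> below (\<Union>i. U i)"
  then have bf: "bcont f" and f0: "\<And>x. f x \<ge> 0" and f1: "\<And>x. f x \<le> indicator (\<Union>i. U i) x"
    by (auto simp: below_def)
  \<comment> \<open>The index \<open>n\<close> is both the number of sets used and the steepness of
    their bumps, so that one decreasing sequence of remainders suffices.\<close>
  define s where "s n x = (\<Sum>i\<le>n. open_bump (U i) n x)" for n x
  define r where "r n x = max 0 (f x - s n x)" for n x
  have bs: "bcont (s n)" for n
    unfolding s_def by (intro bcont_sum bcont_open_bump)
  have br: "bcont (r n)" for n
    unfolding r_def by (intro bcont_max bcont_diff bf bs bcont_const)
  have s_mono: "s m x \<le> s n x" if "m \<le> n" for m n x
    unfolding s_def using that
    by (intro order_trans[OF sum_mono sum_mono2] open_bump_mono) (auto simp: open_bump_nonneg)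
  have r0: "(\<lambda>n. r n x) \<longlonglongrightarrow> 0" for x
  proof (cases "x \<in> (\<Union>i. U i)")
    case True
    then obtain i where i: "x \<in> U i" by auto
    have le: "r n x \<le> 1 - open_bump (U i) n x" if "n \<ge> i" for n
    proof -
      have "open_bump (U i) n x \<le> s n x"
        unfolding s_def using that by (intro member_le_sum) (auto simp: open_bump_nonneg)
      moreover have "f x \<le> 1" using f1[of x] True by simp
      moreover have "open_bump (U i) n x \<le> 1"
        using open_bump_le_indicator[of "U i" n x] i by simp
      ultimately show ?thesis unfolding r_def by simp
    qed
    have "(\<lambda>n. 1 - open_bump (U i) n x) \<longlonglongrightarrow> 1 - 1"
      by (intro tendsto_intros open_bump_tendsto op i)
    then have lim: "(\<lambda>n. 1 - open_bump (U i) n x) \<longlonglongrightarrow> 0" by simp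
    show ?thesis
    proof (rule tendsto_sandwich[OF _ _ tendsto_const lim])
      show "\<forall>\<^sub>F n in sequentially. 0 \<le> r n x" by (simp add: r_def)
      show "\<forall>\<^sub>F n in sequentially. r n x \<le> 1 - open_bump (U i) n x"
        by (rule eventually_sequentiallyI) (rule le)
    qed
  next
    case False
    then have "f x = 0" using f0[of x] f1[of x] by auto
    then have "r n x = 0" for n
      using sum_nonneg[of "{..n}" "\<lambda>i. open_bump (U i) n x"]
      by (auto simp: r_def s_def open_bump_nonneg)
    then show ?thesis by simp
  qed
  have lim: "(\<lambda>n. \<Lambda> (r n)) \<longlonglongrightarrow> 0"
  proof (intro decseq_tendsto_0 br r0)
    show "decseq (\<lambda>n. r n x)" for x
      unfolding decseq_def r_def by (intro allI impI max.mono diff_mono order_refl s_mono)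
  qed
  have "ennreal (\<Lambda> f) \<le> (\<Sum>i. open_content (U i)) + ennreal (\<Lambda> (r n))" for n
  proof -
    have bnn: "\<Lambda> (open_bump (U i) n) \<ge> 0" for i
      by (intro nonneg bcont_open_bump open_bump_nonneg)
    have "\<Lambda> f \<le> \<Lambda> (\<lambda>x. s n x + r n x)"
      by (intro mono bf bcont_add bs br) (auto simp: r_def)
    also have "\<dots> = (\<Sum>i\<le>n. \<Lambda> (open_bump (U i) n)) + \<Lambda> (r n)"
      unfolding add[OF bs br] unfolding s_def by (subst sum) (auto intro: bcont_open_bump)
    finally have "ennreal (\<Lambda> f) \<le> ennreal (\<Sum>i\<le>n. \<Lambda> (open_bump (U i) n)) + ennreal (\<Lambda> (r n))"
      by (subst ennreal_plus[symmetric])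
         (auto intro!: sum_nonneg bnn nonneg br ennreal_leI simp: r_def)
    also have "ennreal (\<Sum>i\<le>n. \<Lambda> (open_bump (U i) n)) = (\<Sum>i\<le>n. ennreal (\<Lambda> (open_bump (U i) n)))"
      by (simp add: sum_ennreal bnn)
    also have "\<dots> \<le> (\<Sum>i\<le>n. open_content (U i))"
      by (intro sum_mono open_content_upper)
         (auto simp: below_def bcont_open_bump open_bump_nonneg open_bump_le_indicator)
    also have "\<dots> \<le> (\<Sum>i. open_content (U i))"
      by (intro sum_le_suminf) auto
    finally show ?thesis by (simp add: add_right_mono)
  qed
  moreover have "(\<lambda>n. (\<Sum>i. open_content (U i)) + ennreal (\<Lambda> (r n)))
      \<longlonglongrightarrow> (\<Sum>i. open_content (U i)) + ennreal 0"
    using lim by (intro tendsto_intros) auto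
  ultimately show "ennreal (\<Lambda> f) \<le> (\<Sum>i. open_content (U i))"
    by (intro LIMSEQ_le_const[of "\<lambda>n. (\<Sum>i. open_content (U i)) + ennreal (\<Lambda> (r n))"]) auto
qed

lemma outer_empty: "outer {} = 0"
proof -
  have "\<Lambda> f = 0" if "f \<in> below {}" for f
  proof -
    have "f = (\<lambda>_. 0)" using that by (auto simp: below_def fun_eq_iff intro: antisym)
    then show ?thesis using const[of 0] by simp
  qed
  then show ?thesis
    by (simp add: outer_open open_content_def)
qed

lemma outer_UN_le:
  fixes A :: "nat \<Rightarrow> 'a set"
  shows "outer (\<Union>i. A i) \<le> (\<Sum>i. outer (A i))"
proof (rule ennreal_le_epsilon)
  fix e :: real assume fin: "(\<Sum>i. outer (A i)) < top" and e: "0 < e"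
  have "\<exists>U. open U \<and> A i \<subseteq> U \<and> open_content U \<le> outer (A i) + ennreal (e * (1/2) ^ Suc i)" for i
  proof -
    have "outer (A i) < top"
    proof -
      have "outer (A i) \<le> (\<Sum>i. outer (A i))"
        using sum_le_suminf[of "\<lambda>i. outer (A i)" "{i}"] by simp
      then show ?thesis using fin by simp
    qed
    then have "outer (A i) < outer (A i) + ennreal (e * (1/2) ^ Suc i)"
      using e ennreal_add_left_cancel_less[of "outer (A i)" 0 "ennreal (e * (1/2) ^ Suc i)"]
      by (simp add: less_top[symmetric])
    then show ?thesis
      unfolding outer_def[of "A i"] INF_less_iff by (auto intro: less_imp_le)
  qed
  then obtain U where U: "\<And>i. open (U i)" "\<And>i. A i \<subseteq> U i"
    "\<And>i. open_content (U i) \<le> outer (A i) + ennreal (e * (1/2) ^ Suc i)"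
    by metis
  have "outer (\<Union>i. A i) \<le> open_content (\<Union>i. U i)"
    unfolding outer_def using U by (intro INF_lower) auto
  also have "\<dots> \<le> (\<Sum>i. open_content (U i))"
    by (intro open_content_UN_le U)
  also have "\<dots> \<le> (\<Sum>i. outer (A i) + ennreal (e * (1/2) ^ Suc i))"
    by (intro suminf_le U) auto
  also have "\<dots> = (\<Sum>i. outer (A i)) + (\<Sum>i. ennreal (e * (1/2) ^ Suc i))"
    by (intro suminf_add[symmetric]) auto
  also have "(\<Sum>i. ennreal (e * (1/2) ^ Suc i)) = ennreal e"
    using e power_half_series[THEN sums_mult[of _ _ e]]
    by (intro suminf_ennreal_eq) auto
  finally show "outer (\<Union>i. A i) \<le> (\<Sum>i. outer (A i)) + ennreal e" .
qed

text \<open>Cutting \<open>f\<close> off at height \<open>e\<close> makes room: the positive part of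
  \<open>f - e\<close> vanishes where \<open>f < e\<close>, an open set containing
  \<open>U - V\<close>. Any function below the part of that set in \<open>U\<close> can therefore be
  added without exceeding the indicator of \<open>U\<close>. The cut costs at most \<open>e\<close>
  because \<open>\<Lambda>\<close> is normalized.\<close>

lemma open_content_split:
  assumes U: "open U" and V: "open V"
  shows "open_content (U \<inter> V) + outer (U - V) \<le> open_content U"
proof -
  have "ennreal (\<Lambda> f) + outer (U - V) \<le> open_content U" if f: "f \<in> below (U \<inter> V)" for f
  proof (rule ennreal_le_epsilon)
    fix e :: real assume e: "0 < e"
    have bf: "bcont f" and f0: "\<And>x. f x \<ge> 0" and f1: "\<And>x. f x \<le> indicator (U \<inter> V) x"
      using f by (auto simp: below_def)
    define f' where "f' x = max 0 (f x - e)" for x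
    have bf': "bcont f'"
      unfolding f'_def by (intro bcont_max bcont_diff bf bcont_const)
    define W where "W = U \<inter> {x. f x < e}"
    have "open {x. f x < e}"
      using bf by (intro open_Collect_less bcont_continuous continuous_on_const)
    then have W: "open W" unfolding W_def using U by auto
    have "x \<in> W" if "x \<in> U - V" for x
      using that f1[of x] e by (auto simp: W_def)
    then have outW: "outer (U - V) \<le> open_content W"
      unfolding outer_def using W by (intro INF_lower) auto
    have g: "ennreal (\<Lambda> f') + ennreal (\<Lambda> g) \<le> open_content U" if g: "g \<in> below W" for g
    proof -
      have bg: "bcont g" and g0: "\<And>x. g x \<ge> 0" and g1: "\<And>x. g x \<le> indicator W x"
        using g by (auto simp: below_def)
      have "f' x + g x \<le> indicator U x" for x
        using f1[of x] g1[of x] g0[of x] f0[of x] e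
        by (cases "x \<in> U"; cases "x \<in> V"; cases "f x < e") (auto simp: f'_def W_def)
      then have "(\<lambda>x. f' x + g x) \<in> below U"
        unfolding below_def using bcont_add[OF bf' bg] g0 by (auto simp: f'_def)
      then have "ennreal (\<Lambda> (\<lambda>x. f' x + g x)) \<le> open_content U"
        by (rule open_content_upper)
      then show ?thesis
        using add[OF bf' bg] nonneg[OF bf'] nonneg[OF bg] g0
        by (subst ennreal_plus[symmetric]) (auto simp: f'_def)
    qed
    have "\<Lambda> f \<le> \<Lambda> (\<lambda>x. f' x + e)"
      by (intro mono bf bcont_add bf' bcont_const) (auto simp: f'_def)
    also have "\<dots> = \<Lambda> f' + e" by (simp add: add bf' const)
    finally have "ennreal (\<Lambda> f) \<le> ennreal (\<Lambda> f' + e)"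
      by (rule ennreal_leI)
    also have "\<dots> = ennreal (\<Lambda> f') + ennreal e"
      using nonneg[OF bf'] e by (intro ennreal_plus) (auto simp: f'_def)
    finally have "ennreal (\<Lambda> f) \<le> ennreal (\<Lambda> f') + ennreal e" .
    then have "ennreal (\<Lambda> f) + outer (U - V) \<le> (ennreal (\<Lambda> f') + ennreal e) + open_content W"
      using outW by (rule add_mono)
    also have "\<dots> = (ennreal (\<Lambda> f') + open_content W) + ennreal e"
      by (simp add: ac_simps)
    also have "ennreal (\<Lambda> f') + open_content W = (SUP g\<in>below W. ennreal (\<Lambda> f') + ennreal (\<Lambda> g))"
      unfolding open_content_def by (subst ennreal_SUP_add_right) auto
    also have "\<dots> \<le> open_content U" by (intro SUP_least g)
    finally show "ennreal (\<Lambda> f) + outer (U - V) \<le> open_content U + ennreal e"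
      by (simp add: add_right_mono)
  qed
  then have "(SUP f\<in>below (U \<inter> V). ennreal (\<Lambda> f) + outer (U - V)) \<le> open_content U"
    by (intro SUP_least)
  then show ?thesis
    unfolding open_content_def[of "U \<inter> V"] by (subst ennreal_SUP_add_left[symmetric]) auto
qed

lemma outer_measure_space_outer: "outer_measure_space UNIV outer"
  unfolding outer_measure_space_def positive_def increasing_def countably_subadditive_def
  using outer_empty outer_mono outer_UN_le by auto

text \<open>Caratheodory's condition passes from open test sets, where it is
  \<open>open_content_split\<close>, to all test sets because \<open>outer\<close> is an infimum
  over open supersets.\<close>

lemma open_in_lambda_system:
  assumes V: "open V"
  shows "V \<in> lambda_system UNIV UNIV outer"
proof -
  interpret algebra UNIV "UNIV :: 'a set set" 
    by (metis Pow_UNIV algebra_Pow)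
  have "outer (X \<inter> V) + outer (X - V) = outer X" for X
  proof (rule antisym)
    show "outer (X \<inter> V) + outer (X - V) \<le> outer X"
      unfolding outer_def[of X]
    proof (rule INF_greatest)
      fix U assume "U \<in> {U. open U \<and> X \<subseteq> U}"
      then have U: "open U" "X \<subseteq> U" by auto
      have "outer (X \<inter> V) + outer (X - V) \<le> outer (U \<inter> V) + outer (U - V)"
        using U by (intro add_mono outer_mono) auto
      also have "\<dots> \<le> open_content U"
        using open_content_split[OF U(1) V] U V by (simp add: outer_open open_Int)
      finally show "outer (X \<inter> V) + outer (X - V) \<le> open_content U" .
    qed
    have "outer X \<le> outer (\<Union>i. binaryset (X \<inter> V) (X - V) i)"
      by (rule outer_mono) (auto simp: UN_binaryset_eq)
    also have "\<dots> \<le> (\<Sum>i. outer (binaryset (X \<inter> V) (X - V) i))"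
      by (rule outer_UN_le)
    also have "\<dots> = outer (X \<inter> V) + outer (X - V)"
      by (rule suminf_binaryset_eq) (rule outer_empty)
    finally show "outer X \<le> outer (X \<inter> V) + outer (X - V)" .
  qed
  then show ?thesis
    by (simp add: lambda_system_eq)
qed

definition rep_measure :: "'a measure" where
  "rep_measure = measure_of UNIV (sets borel) outer"

lemma sets_rep_measure[simp]: "sets rep_measure = sets borel"
  unfolding rep_measure_def by (metis sets.sets_measure_of_eq space_borel)

lemma emeasure_rep_measure: "A \<in> sets borel \<Longrightarrow> emeasure rep_measure A = outer A"
proof -
  interpret sigma_algebra UNIV "UNIV :: 'a set set"
    by (metis Pow_UNIV sigma_algebra_Pow)
  let ?L = "lambda_system UNIV (UNIV :: 'a set set) outer"
  have ms: "measure_space UNIV ?L outer"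
    by (rule caratheodory_lemma[OF outer_measure_space_outer])
  then have sa: "sigma_algebra UNIV ?L" by (simp add: measure_space_def)
  have sub: "sets borel \<subseteq> ?L"
    unfolding sets_borel
    by (rule sigma_algebra.sigma_sets_subset[OF sa]) (auto intro: open_in_lambda_system)
  have "measure_space UNIV (sets borel) outer"
    using ms sub sets.sigma_algebra_axioms[of "borel :: 'a measure"]
    by (auto intro: measure_down)
  then have "positive (sets borel) outer" "countably_additive (sets borel) outer"
    by (auto simp: measure_space_def)
  then show "A \<in> sets borel \<Longrightarrow> emeasure rep_measure A = outer A"
    using emeasure_measure_of_sigma[of UNIV "sets borel" outer A]
      sets.sigma_algebra_axioms[of "borel :: 'a measure"]
    by (auto simp: rep_measure_def)
qed

lemma emeasure_rep_measure_open: "open U \<Longrightarrow> emeasure rep_measure U = open_content U"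
  by (simp add: emeasure_rep_measure outer_open)

lemma prob_space_rep_measure: "prob_space rep_measure"
proof
  have "space rep_measure = UNIV"
    using sets_eq_imp_space_eq[OF sets_rep_measure] by simp
  then show "emeasure rep_measure (space rep_measure) = 1"
    using emeasure_rep_measure_open[of UNIV] open_content_UNIV by simp
qed

text \<open>The layer \<open>s k\<close> of \<open>n * f\<close> lies below the indicator of the
  level set \<open>{f > k / n}\<close> and above that of \<open>{f > (k + 1) / n}\<close>. Using the
  first for \<open>\<Lambda>\<close> and the second for the integral shifts the index by one, an
  error of at most 1 for \<open>n * f\<close> and hence of \<open>1 / n\<close> for
  \<open>f\<close>.\<close>

lemma le_integral_rep_measure:
  assumes bf: "bcont f" and f01: "\<And>x. 0 \<le> f x" "\<And>x. f x \<le> 1"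
  shows "\<Lambda> f \<le> (\<integral>x. f x \<partial>rep_measure)"
proof (rule field_le_epsilon)
  fix e :: real assume "e > 0"
  then obtain n :: nat where n: "n > 0" "1 / real n < e"
    using nat_approx_posE by (metis of_nat_Suc zero_less_Suc)
  interpret prob_space rep_measure by (rule prob_space_rep_measure)
  let ?U = "\<lambda>k. {x. real k < real n * f x}"
  define s where "s k x = min 1 (max 0 (real n * f x - real k))" for k :: nat and x
  have bs: "bcont (s k)" for k
    unfolding s_def by (intro bcont_min bcont_max bcont_diff bcont_mult bf bcont_const)
  have opU: "open (?U k)" for k
    by (intro open_Collect_less continuous_intros bcont_continuous bf)
  have upper: "\<Lambda> (s k) \<le> prob (?U k)" for k
  proof -
    have "s k \<in> below (?U k)"
      using bs by (auto simp: below_def s_def indicator_def)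
    then have "ennreal (\<Lambda> (s k)) \<le> emeasure rep_measure (?U k)"
      using open_content_upper emeasure_rep_measure_open[OF opU] by metis
    then show ?thesis
      by (simp add: emeasure_eq_measure ennreal_le_iff)
  qed
  have lower: "prob (?U (Suc k)) \<le> (\<integral>x. s k x \<partial>rep_measure)" for k
  proof -
    have "prob (?U (Suc k)) = (\<integral>x. indicator (?U (Suc k)) x \<partial>rep_measure)"
      using opU[of "Suc k"] by simp
    also have "\<dots> \<le> (\<integral>x. s k x \<partial>rep_measure)"
      using opU[of "Suc k"]
      by (intro integral_mono bcont_integrable[OF bs prob_space_rep_measure] integrable_real_indicator)
         (auto simp: s_def indicator_def emeasure_eq_measure)
    finally show ?thesis .
  qed
  have sum_s: "(\<Sum>k<n. s k x) = real n * f x" for x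
    unfolding s_def using f01[of x] sum_unit_slices[of "real n * f x" n]
    by (auto simp: mult_left_le)
  have "real n * \<Lambda> f = (\<Sum>k<n. \<Lambda> (s k))"
    using sum[of "{..<n}" s] bs scale[OF bf, of "real n"] by (simp add: sum_s)
  also have "\<dots> \<le> (\<Sum>k<n. prob (?U k))" by (intro sum_mono upper)
  \<comment> \<open>The extra term \<open>k = n\<close> permits the index shift; the term
    \<open>?U 0\<close> that is split off costs at most 1.\<close>
  also have "\<dots> \<le> (\<Sum>k<Suc n. prob (?U k))" by simp
  also have "\<dots> = prob (?U 0) + (\<Sum>k<n. prob (?U (Suc k)))"
    by (rule sum.lessThan_Suc_shift)
  also have "\<dots> \<le> 1 + (\<Sum>k<n. \<integral>x. s k x \<partial>rep_measure)"
    by (intro add_mono sum_mono lower) auto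
  also have "(\<Sum>k<n. \<integral>x. s k x \<partial>rep_measure) = (\<integral>x. real n * f x \<partial>rep_measure)"
    by (subst Bochner_Integration.integral_sum[symmetric])
       (auto intro: bcont_integrable[OF bs prob_space_rep_measure] simp: sum_s)
  finally have "real n * \<Lambda> f \<le> 1 + real n * (\<integral>x. f x \<partial>rep_measure)" by simp
  then have "\<Lambda> f \<le> 1 / real n + (\<integral>x. f x \<partial>rep_measure)"
    using n by (simp add: field_simps)
  then show "\<Lambda> f \<le> (\<integral>x. f x \<partial>rep_measure) + e" using n by simp
qed

text \<open>Applying \<open>le_integral_rep_measure\<close> to both \<open>g\<close> and
  \<open>1 - g\<close> gives equality for values in \<open>[0, 1]\<close>; an affine change of scale
  brings every bounded function into this range.\<close>

lemma integral_rep_measure: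
  assumes bf: "bcont f"
  shows "(\<integral>x. f x \<partial>rep_measure) = \<Lambda> f"
proof -
  interpret prob_space rep_measure by (rule prob_space_rep_measure)
  have eq: "(\<integral>x. g x \<partial>rep_measure) = \<Lambda> g"
    if g: "bcont g" "\<And>x. 0 \<le> g x" "\<And>x. g x \<le> 1" for g
  proof (rule antisym)
    have "\<Lambda> (\<lambda>x. 1 - g x) \<le> (\<integral>x. 1 - g x \<partial>rep_measure)"
      using g by (intro le_integral_rep_measure bcont_diff) auto
    moreover have "\<Lambda> (\<lambda>x. 1 - g x) = 1 - \<Lambda> g"
      using g one by (simp add: diff)
    moreover have "(\<integral>x. 1 - g x \<partial>rep_measure) = 1 - (\<integral>x. g x \<partial>rep_measure)"
      using bcont_integrable[OF g(1) prob_space_rep_measure] by (simp add: prob_space)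
    ultimately show "(\<integral>x. g x \<partial>rep_measure) \<le> \<Lambda> g" by simp
  qed (use g le_integral_rep_measure in auto)
  obtain B where B: "B > 0" "\<And>x. \<bar>f x\<bar> \<le> B" using bf bcont_bound by blast
  define g where "g x = (1 / (2 * B)) * (f x + B)" for x
  have bg: "bcont g"
    unfolding g_def by (intro bcont_mult bcont_add bf bcont_const)
  have "0 \<le> g x" "g x \<le> 1" for x
    using B(2)[of x] B(1) by (auto simp: g_def field_simps abs_le_iff)
  then have "(\<integral>x. g x \<partial>rep_measure) = \<Lambda> g" by (intro eq bg)
  moreover have f_eq: "f = (\<lambda>x. 2 * B * g x - B)"
    using B by (auto simp: g_def)
  moreover have "\<Lambda> (\<lambda>x. 2 * B * g x - B) = 2 * B * \<Lambda> g - B"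
    using bg by (subst diff) (auto simp: scale const)
  moreover have "(\<integral>x. 2 * B * g x - B \<partial>rep_measure) = 2 * B * (\<integral>x. g x \<partial>rep_measure) - B"
    using bcont_integrable[OF bg prob_space_rep_measure] by (simp add: prob_space)
  ultimately show ?thesis by simp
qed

end

section \<open>Tightness and weak convergence\<close>

lemma infdist_less_iff:
  "A \<noteq> {} \<Longrightarrow> infdist x A < r \<longleftrightarrow> (\<exists>y\<in>A. dist x y < r)"
  by (subst infdist_notempty) (auto intro!: cINF_less_iff bdd_belowI2[where m = 0])

text \<open>Tychonoff's theorem: each law is a point of a product of compact intervals, with one
  factor per function. The product has uncountably many factors, so a cluster point need not be the
  limit of a subsequence; the filter \<open>G\<close> takes the place of one.\<close>

lemma cluster_functional:
  fixes \<mu> :: "nat \<Rightarrow> 'a::topological_space measure"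
  assumes prob: "\<And>n. prob_space (\<mu> n)" and sets: "\<And>n. sets (\<mu> n) = sets borel"
  obtains G \<Lambda> where "G \<noteq> bot" "G \<le> sequentially"
    "\<And>f. bcont f \<Longrightarrow> ((\<lambda>n. \<integral>x. f x \<partial>\<mu> n) \<longlongrightarrow> \<Lambda> f) G"
proof -
  have "\<exists>B. \<forall>f::'a \<Rightarrow> real. bcont f \<longrightarrow> (\<forall>x. \<bar>f x\<bar> \<le> B f)"
    by (rule choice) (meson bcont_bound)
  then obtain B :: "('a \<Rightarrow> real) \<Rightarrow> real" where B: "\<And>f x. bcont f \<Longrightarrow> \<bar>f x\<bar> \<le> B f"
    by metis
  \<comment> \<open>Outside \<open>bcont\<close> the coordinate is pinned to 0, which keeps every
    factor compact.\<close>
  define S where "S f = (if bcont f then {- B f..B f} else {0})" for f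
  define \<Phi> where "\<Phi> n f = (if bcont f then \<integral>x. f x \<partial>\<mu> n else 0)" for n f
  have \<Phi>: "\<Phi> n \<in> Pi\<^sub>E UNIV S" for n
  proof -
    interpret prob_space "\<mu> n" by (rule prob)
    have "\<bar>\<integral>x. f x \<partial>\<mu> n\<bar> \<le> B f" if f: "bcont f" for f
    proof -
      have int: "integrable (\<mu> n) f" by (rule bcont_integrable[OF f prob sets])
      have "- B f \<le> (\<integral>x. f x \<partial>\<mu> n)"
        by (intro integral_ge_const int AE_I2) (use B[OF f] in \<open>simp add: abs_le_iff minus_le_iff\<close>)
      moreover have "(\<integral>x. f x \<partial>\<mu> n) \<le> B f"
        by (intro integral_le_const int AE_I2) (use B[OF f] in \<open>simp add: abs_le_iff\<close>)
      ultimately show ?thesis by simp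
    qed
    then show ?thesis
      by (auto simp: \<Phi>_def S_def abs_le_iff minus_le_iff)
  qed
  have "compactin (product_topology (\<lambda>_. euclidean) UNIV) (Pi\<^sub>E UNIV S)"
    unfolding compactin_PiE by (auto simp: S_def)
  then have "compact (Pi\<^sub>E UNIV S)"
    by (simp add: euclidean_product_topology)
  then obtain \<Lambda> where \<Lambda>: "inf (nhds \<Lambda>) (filtermap \<Phi> sequentially) \<noteq> bot"
    using \<Phi> unfolding compact_filter
    by (metis (no_types, lifting) always_eventually eventually_filtermap filtermap_bot_iff
        sequentially_bot)
  \<comment> \<open>Pulling the neighbourhoods of the cluster point back along \<open>\<Phi>\<close>
    makes all integrals converge simultaneously along one filter.\<close>
  define G where "G = inf (filtercomap \<Phi> (nhds \<Lambda>)) sequentially"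
  have "G \<noteq> bot"
  proof
    assume "G = bot"
    then obtain P Q where PQ: "eventually P (nhds \<Lambda>)" "eventually Q sequentially"
      "\<And>n. P (\<Phi> n) \<Longrightarrow> Q n \<Longrightarrow> False"
      unfolding trivial_limit_def G_def eventually_inf eventually_filtercomap by blast
    have "eventually (\<lambda>\<phi>. \<exists>n. Q n \<and> \<phi> = \<Phi> n) (filtermap \<Phi> sequentially)"
      unfolding eventually_filtermap using PQ(2) by (rule eventually_mono) auto
    then have "eventually (\<lambda>_. False) (inf (nhds \<Lambda>) (filtermap \<Phi> sequentially))"
      unfolding eventually_inf using PQ(1,3) by (intro exI[of _ P] exI conjI) auto
    with \<Lambda> show False by (simp add: trivial_limit_def)
  qed
  moreover have "G \<le> sequentially" by (simp add: G_def)
  moreover have "((\<lambda>n. \<integral>x. f x \<partial>\<mu> n) \<longlongrightarrow> \<Lambda> f) G" if f: "bcont f" for f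
  proof -
    have "filterlim \<Phi> (nhds \<Lambda>) G"
      unfolding G_def by (rule filterlim_mono[OF filterlim_filtercomap]) auto
    moreover have "((\<lambda>\<phi>. \<phi> f) \<longlongrightarrow> \<Lambda> f) (nhds \<Lambda>)"
      using continuous_on_product_coordinates[of f]
      by (metis UNIV_I at_within_open continuous_on_def filterlim_at_within_closure_implies_filterlim
          nhds_neq_bot open_UNIV tendsto_at_iff_tendsto_nhds)
    ultimately have "((\<lambda>n. \<Phi> n f) \<longlongrightarrow> \<Lambda> f) G"
      by (rule filterlim_compose[rotated])
    then show ?thesis using f by (simp add: \<Phi>_def)
  qed
  ultimately show ?thesis using that by blast
qed

definition tight_seq :: "(nat \<Rightarrow> 'a::topological_space measure) \<Rightarrow> bool" where
  "tight_seq \<mu> \<longleftrightarrow> (\<forall>e>0. \<exists>C. compact C \<and> (\<forall>n. 1 - e \<le> measure (\<mu> n) C))"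

text \<open>Dini's theorem on a compact set that carries almost all mass of every
  \<open>\<mu> n\<close>; on the complement \<open>F k \<le> F 0 \<le> B\<close>. One
  \<open>k\<close> serves all \<open>n\<close>, so the bound survives the passage to a cluster
  point.\<close>

lemma tight_seq_decseq:
  fixes \<mu> :: "nat \<Rightarrow> 'a::t2_space measure"
  assumes prob: "\<And>n. prob_space (\<mu> n)" and sets: "\<And>n. sets (\<mu> n) = sets borel"
    and tight: "tight_seq \<mu>" and F: "\<And>k. bcont (F k)"
    and dec: "\<And>x. decseq (\<lambda>k. F k x)" and lim: "\<And>x. (\<lambda>k. F k x) \<longlonglongrightarrow> 0"
    and e: "e > (0::real)"
  obtains k where "\<And>n. (\<integral>x. F k x \<partial>\<mu> n) \<le> e"
proof -
  obtain B where B: "B > 0" "\<And>x. \<bar>F 0 x\<bar> \<le> B" using bcont_bound[OF F[of 0]] by auto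
  \<comment> \<open>Mass at most \<open>e / (2 * B)\<close> off \<open>C\<close> contributes at most
    \<open>e / 2\<close>; the other half is the bound for \<open>F k\<close> on
    \<open>C\<close>.\<close>
  obtain C where C: "compact C" "\<And>n. 1 - e / (2 * B) \<le> measure (\<mu> n) C"
    using tight e B(1) unfolding tight_seq_def by (meson divide_pos_pos mult_pos_pos zero_less_numeral)
  have op: "open {x. F k x < e / 2}" for k
    by (intro open_Collect_less bcont_continuous F continuous_on_const)
  have cover: "C \<subseteq> (\<Union>k. {x. F k x < e / 2})"
  proof
    fix x
    have "eventually (\<lambda>k. F k x < e / 2) sequentially"
      using lim[of x] e by (intro order_tendstoD) auto
    then show "x \<in> (\<Union>k. {x. F k x < e / 2})"
      by (auto simp: eventually_sequentially)
  qed
  from compactE_image[OF C(1) op cover] obtain I where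
    I: "finite I" "C \<subseteq> (\<Union>k\<in>I. {x. F k x < e / 2})" by metis
  define k where "k = Max (insert 0 I)"
  have small: "F k x < e / 2" if x: "x \<in> C" for x
  proof -
    obtain i where i: "i \<in> I" "F i x < e / 2" using I(2) x by blast
    then have "i \<le> k" using I(1) by (simp add: k_def)
    then have "F k x \<le> F i x" using dec[of x] by (simp add: decseq_def)
    then show ?thesis using i by simp
  qed
  have "(\<integral>x. F k x \<partial>\<mu> n) \<le> e" for n
  proof -
    interpret prob_space "\<mu> n" by (rule prob)
    have space: "space (\<mu> n) = UNIV" using sets_eq_imp_space_eq[OF sets] by simp
    have Cm: "C \<in> sets (\<mu> n)" using C(1) sets by (simp add: compact_imp_closed)
    have "F k x \<le> e / 2 + B * indicator (- C) x" for x
    proof (cases "x \<in> C")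
      case False
      have "F k x \<le> F 0 x" using dec[of x] by (simp add: decseq_def)
      then show ?thesis using B(2)[of x] False e by simp
    qed (use small in force)
    then have "(\<integral>x. F k x \<partial>\<mu> n) \<le> (\<integral>x. e / 2 + B * indicator (- C) x \<partial>\<mu> n)"
      using Cm sets.compl_sets[OF Cm]
      by (intro integral_mono bcont_integrable[OF F prob sets] Bochner_Integration.integrable_add
           integrable_mult_right integrable_real_indicator)
         (auto simp: space Compl_eq_Diff_UNIV emeasure_eq_measure)
    also have "\<dots> = e / 2 + B * prob (- C)"
      using Cm sets.compl_sets[OF Cm]
      by (subst Bochner_Integration.integral_add)
         (use prob_space in \<open>auto simp: space Compl_eq_Diff_UNIV emeasure_eq_measure\<close>)
    also have "prob (- C) = 1 - prob C"
      using prob_compl[OF Cm] by (simp add: space Compl_eq_Diff_UNIV)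
    also have "\<dots> \<le> e / (2 * B)" using C(2)[of n] by simp
    finally show ?thesis using B(1) by (simp add: field_simps)
  qed
  then show ?thesis by (rule that)
qed

text \<open>The compactness half of Prokhorov's theorem, with a filter instead of a subsequence.
  Linearity and positivity are inherited along \<open>G\<close>; tightness supplies the monotone
  continuity that a Daniell functional must have.\<close>

lemma tight_seq_cluster:
  fixes \<mu> :: "nat \<Rightarrow> 'a::metric_space measure"
  assumes prob: "\<And>n. prob_space (\<mu> n)" and sets: "\<And>n. sets (\<mu> n) = sets borel"
    and tight: "tight_seq \<mu>"
  obtains G \<pi> where "G \<noteq> bot" "G \<le> sequentially" "prob_space \<pi>" "sets \<pi> = sets borel"
    "\<And>f. bcont f \<Longrightarrow> ((\<lambda>n. \<integral>x. f x \<partial>\<mu> n) \<longlongrightarrow> (\<integral>x. f x \<partial>\<pi>)) G"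
proof -
  obtain G \<Lambda> where G: "G \<noteq> bot" "G \<le> sequentially"
    and \<Lambda>: "\<And>f. bcont f \<Longrightarrow> ((\<lambda>n. \<integral>x. f x \<partial>\<mu> n) \<longlongrightarrow> \<Lambda> f) G"
    by (rule cluster_functional[of \<mu>, OF prob sets]) blast
  have int: "integrable (\<mu> n) f" if "bcont f" for f n
    by (rule bcont_integrable[OF that prob sets])
  have nn: "\<Lambda> f \<ge> 0" if f: "bcont f" "\<And>x. f x \<ge> 0" for f
    by (rule tendsto_lowerbound[OF \<Lambda>[OF f(1)] _ G(1)]) (simp add: f(2))
  interpret daniell_functional \<Lambda>
  proof
    fix f g :: "'a \<Rightarrow> real" assume f: "bcont f" and g: "bcont g"
    have "((\<lambda>n. (\<integral>x. f x \<partial>\<mu> n) + (\<integral>x. g x \<partial>\<mu> n)) \<longlongrightarrow> \<Lambda> f + \<Lambda> g) G"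
      by (intro tendsto_add \<Lambda> f g)
    then show "\<Lambda> (\<lambda>x. f x + g x) = \<Lambda> f + \<Lambda> g"
      using \<Lambda>[OF bcont_add[OF f g]] tendsto_unique[OF G(1)]
      by (simp add: Bochner_Integration.integral_add[OF int[OF f] int[OF g]])
  next
    fix f :: "'a \<Rightarrow> real" and c assume f: "bcont f"
    have "((\<lambda>n. c * (\<integral>x. f x \<partial>\<mu> n)) \<longlongrightarrow> c * \<Lambda> f) G"
      by (intro tendsto_mult tendsto_const \<Lambda> f)
    then show "\<Lambda> (\<lambda>x. c * f x) = c * \<Lambda> f"
      using \<Lambda>[OF bcont_mult[OF bcont_const f], of c] tendsto_unique[OF G(1)]
      by simp
  next
    have "((\<lambda>n. 1) \<longlongrightarrow> \<Lambda> (\<lambda>_. 1)) G"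
      using \<Lambda>[OF bcont_const[of 1]] prob_space.prob_space[OF prob] by simp
    then show "\<Lambda> (\<lambda>_. 1) = 1"
      by (rule tendsto_unique[OF G(1) _ tendsto_const])
  next
    fix F :: "nat \<Rightarrow> 'a \<Rightarrow> real"
    assume F: "\<And>n. bcont (F n)" and dec: "\<And>x. decseq (\<lambda>n. F n x)"
      and lim: "\<And>x. (\<lambda>n. F n x) \<longlonglongrightarrow> 0"
    have F0: "F n x \<ge> 0" for n x using decseq_ge[OF dec lim] by simp
    show "(\<lambda>n. \<Lambda> (F n)) \<longlonglongrightarrow> 0"
    proof (rule LIMSEQ_I)
      fix e :: real assume "e > 0"
      then obtain k where k: "\<And>n. (\<integral>x. F k x \<partial>\<mu> n) \<le> e / 2"
        using tight_seq_decseq[OF prob sets tight F dec lim, of "e / 2"] by auto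
      have "norm (\<Lambda> (F m) - 0) < e" if "m \<ge> k" for m
      proof -
        have "(\<integral>x. F m x \<partial>\<mu> n) \<le> e / 2" for n
          using dec that
          by (intro order_trans[OF integral_mono k] int F) (auto simp: decseq_def)
        then have "\<Lambda> (F m) \<le> e / 2"
          by (intro tendsto_upperbound[OF \<Lambda>[OF F] _ G(1)]) simp
        then show ?thesis using nn[OF F F0, of m] \<open>e > 0\<close> by simp
      qed
      then show "\<exists>k. \<forall>m\<ge>k. norm (\<Lambda> (F m) - 0) < e" by blast
    qed
  qed (rule nn)
  show ?thesis
    using G prob_space_rep_measure sets_rep_measure \<Lambda> integral_rep_measure that by metis
qed

text \<open>The intersection of shrinking neighbourhoods of compact sets is closed and totally
  bounded, hence compact by completeness, and the masses lost add up to at most \<open>e\<close>.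
  Neighbourhoods appear in the criterion because its negation then provides mass at a positive
  distance from any given compact set.\<close>

lemma tight_seqI:
  fixes \<mu> :: "nat \<Rightarrow> 'a::complete_space measure"
  assumes prob: "\<And>n. prob_space (\<mu> n)" and sets: "\<And>n. sets (\<mu> n) = sets borel"
    and near: "\<And>e. e > 0 \<Longrightarrow> \<exists>C. compact C \<and> C \<noteq> {} \<and> (\<forall>n. 1 - e \<le> measure (\<mu> n) {x. infdist x C < e})"
  shows "tight_seq \<mu>"
  unfolding tight_seq_def
proof (intro allI impI)
  fix e :: real assume e: "e > 0"
  \<comment> \<open>A geometric series with sum \<open>e\<close>; stage \<open>k\<close> uses
    \<open>d k\<close> both as radius and as lost mass.\<close>
  define d where "d k = e * (1 / 2) ^ Suc k" for k
  have d0: "d k > 0" for k using e by (simp add: d_def)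
  obtain C where C: "\<And>k. compact (C k)" "\<And>k. C k \<noteq> {}"
    "\<And>k n. 1 - d k \<le> measure (\<mu> n) {x. infdist x (C k) < d k}"
    using near[OF d0] by metis
  define K where "K = (\<Inter>k. {x. infdist x (C k) \<le> d k})"
  have closedK: "closed K"
    unfolding K_def by (intro closed_INT ballI closed_Collect_le continuous_intros)
  have tot: "\<exists>S. finite S \<and> K \<subseteq> (\<Union>x\<in>S. ball x r)" if r: "r > 0" for r
  proof -
    obtain k where k: "d k < r / 2"
      using real_arch_pow_inv[of "r / e" "1 / 2"] r e
      by (auto simp: d_def field_simps)
    obtain S where S: "finite S" "C k \<subseteq> (\<Union>x\<in>S. ball x (r / 2))"
      using C(1)[of k] r unfolding compact_eq_totally_bounded by (meson half_gt_zero)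
    have "x \<in> (\<Union>y\<in>S. ball y r)" if x: "x \<in> K" for x
    proof -
      have "infdist x (C k) < r / 2" proof (rule le_less_trans[OF _ k])
        show "infdist x (C k) \<le> d k" using x by (simp add: K_def)
      qed
      then obtain y where y: "y \<in> C k" "dist x y < r / 2"
        using infdist_less_iff[OF C(2)] by blast
      then obtain s where s: "s \<in> S" "dist s y < r / 2" using S(2) by auto
      have "dist s x < r"
        using y s dist_triangle[of s x y] by (simp add: dist_commute)
      then show ?thesis using s by auto
    qed
    then show ?thesis using S by blast
  qed
  have "compact K"
    unfolding compact_eq_totally_bounded complete_eq_closed using closedK tot by blast
  moreover have "1 - e \<le> measure (\<mu> n) K" for n
  proof -
    interpret prob_space "\<mu> n" by (rule prob)
    have space: "space (\<mu> n) = UNIV" using sets_eq_imp_space_eq[OF sets] by simp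
    let ?A = "\<lambda>k. {x. d k < infdist x (C k)}"
    have Am: "?A k \<in> sets (\<mu> n)" for k
      using sets by (auto intro!: borel_open open_Collect_less continuous_intros)
    have A_le: "prob (?A k) \<le> d k" for k
    proof -
      have m: "{x. infdist x (C k) < d k} \<in> sets (\<mu> n)"
        using sets by (auto intro!: borel_open open_Collect_less continuous_intros)
      have "prob (?A k) \<le> prob (space (\<mu> n) - {x. infdist x (C k) < d k})"
        using sets.compl_sets[OF m] by (intro finite_measure_mono) (auto simp: space)
      also have "\<dots> \<le> d k" using prob_compl[OF m] C(3)[of k n] by simp
      finally show ?thesis .
    qed
    have sd: "d sums e"
      unfolding d_def using sums_mult[OF power_half_series, of e] by simp
    have sum: "summable (\<lambda>k. prob (?A k))"
      by (rule summable_comparison_test[OF _ sums_summable[OF sd]]) (auto intro: A_le)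
    have "prob (\<Union>k. ?A k) \<le> (\<Sum>k. prob (?A k))"
      using Am by (intro finite_measure_subadditive_countably sum) auto
    also have "\<dots> \<le> (\<Sum>k. d k)"
      by (intro suminf_le A_le sum sums_summable[OF sd])
    also have "\<dots> = e" using sd by (rule sums_unique[symmetric])
    finally have "prob (\<Union>k. ?A k) \<le> e" .
    moreover have "(\<Union>k. ?A k) = space (\<mu> n) - K" by (auto simp: K_def space simp flip: not_le)
    ultimately show ?thesis
      using prob_compl[of K] closedK sets by simp
  qed
  ultimately show "\<exists>C. compact C \<and> (\<forall>n. 1 - e \<le> measure (\<mu> n) C)" by blast
qed

section \<open>Lipschitz test functions determine measures and weak limits\<close>

definition bounded_lipschitz :: "('a::metric_space \<Rightarrow> real) \<Rightarrow> bool" where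
  "bounded_lipschitz f \<longleftrightarrow> (\<exists>L. L-lipschitz_on UNIV f) \<and> bounded (range f)"

lemma bounded_lipschitz_bcont: "bounded_lipschitz f \<Longrightarrow> bcont f"
  unfolding bounded_lipschitz_def bcont_def using lipschitz_on_continuous_on by blast

lemma bounded_lipschitzI:
  fixes f :: "'a::metric_space \<Rightarrow> real"
  assumes "L \<ge> 0" "\<And>x y. f x \<le> f y + L * dist x y" "\<And>x. \<bar>f x\<bar> \<le> B"
  shows "bounded_lipschitz f"
proof -
  have "dist (f x) (f y) \<le> L * dist x y" for x y
    using assms(2)[of x y] assms(2)[of y x] by (auto simp: dist_real_def dist_commute abs_le_iff)
  then have "L-lipschitz_on UNIV f" using assms(1) by (intro lipschitz_onI) auto
  moreover have "bounded (range f)" using assms(3) by (auto simp: bounded_iff)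
  ultimately show ?thesis unfolding bounded_lipschitz_def by auto
qed

text \<open>Inf-convolution with the cone \<open>k * dist\<close>: an infimum of
  \<open>k\<close>-Lipschitz functions is \<open>k\<close>-Lipschitz, and a steep cone makes distant
  points too expensive to compete with \<open>x\<close> itself.\<close>

lemma bcont_lipschitz_approx:
  fixes f :: "'a::metric_space \<Rightarrow> real"
  assumes f: "bcont f"
  obtains g B where "\<And>k. bounded_lipschitz (g k)" "\<And>k x. g k x \<le> f x" "\<And>k x. \<bar>g k x\<bar> \<le> B"
    "\<And>x. (\<lambda>k::nat. g k x) \<longlonglongrightarrow> f x"
proof -
  obtain B where B: "B > 0" "\<And>x. \<bar>f x\<bar> \<le> B" using bcont_bound[OF f] by blast
  define g where "g k x = (INF y. f y + real k * dist x y)" for k x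
  have lb: "- B \<le> f y + real k * dist x y" for k x y
    using B(2)[of y] zero_le_dist[of x y] by (smt (verit) mult_nonneg_nonneg of_nat_0_le_iff)
  then have bdd: "bdd_below (range (\<lambda>y. f y + real k * dist x y))" for k x
    by (intro bdd_belowI2[where m = "- B"]) auto
  have gle: "g k x \<le> f y + real k * dist x y" for k x y
    unfolding g_def by (rule cINF_lower[OF bdd]) simp
  have glef: "g k x \<le> f x" for k x using gle[of k x x] by simp
  have gge: "- B \<le> g k x" for k x
    unfolding g_def by (rule cINF_greatest) (auto intro: lb)
  have gB: "\<bar>g k x\<bar> \<le> B" for k x
    using gge[of k x] glef[of k x] B(2)[of x] by (auto simp: abs_le_iff)
  have "bounded_lipschitz (g k)" for k
  proof (rule bounded_lipschitzI[OF _ _ gB])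
    fix x y
    have "g k x - real k * dist x y \<le> g k y"
      unfolding g_def[of k y]
    proof (rule cINF_greatest)
      fix w
      have "g k x \<le> f w + real k * dist x w" by (rule gle)
      also have "\<dots> \<le> f w + real k * (dist x y + dist y w)"
        by (intro add_left_mono mult_left_mono dist_triangle) auto
      finally show "g k x - real k * dist x y \<le> f w + real k * dist y w"
        by (simp add: algebra_simps)
    qed simp
    then show "g k x \<le> g k y + real k * dist x y" by simp
  qed simp
  moreover have "(\<lambda>k. g k x) \<longlonglongrightarrow> f x" for x
  proof (rule LIMSEQ_I)
    fix e :: real assume e: "e > 0"
    have "continuous (at x) f" using f by (auto simp: bcont_def continuous_on_eq_continuous_at)
    then obtain d where d: "d > 0" "\<And>y. dist x y < d \<Longrightarrow> \<bar>f y - f x\<bar> < e / 2"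
      using e unfolding continuous_at_eps_delta
      by (metis dist_commute dist_real_def half_gt_zero)
    \<comment> \<open>From distance \<open>d\<close> on, the penalty exceeds \<open>2 * B\<close>,
      the largest possible drop of \<open>f\<close>.\<close>
    obtain N :: nat where N: "2 * B < real N * d" using d(1) reals_Archimedean3 by blast
    have "norm (g k x - f x) < e" if k: "k \<ge> N" for k
    proof -
      have "f x - e / 2 \<le> g k x"
        unfolding g_def
      proof (rule cINF_greatest)
        fix y
        show "f x - e / 2 \<le> f y + real k * dist x y"
        proof (cases "dist x y < d")
          case True
          have "0 \<le> real k * dist x y" by simp
          then show ?thesis using d(2)[OF True] by linarith
        next
          case False
          then have "2 * B \<le> real k * dist x y"
            using N k d(1) by (smt (verit) mult_mono of_nat_0_le_iff of_nat_mono)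
          then show ?thesis using B(2)[of x] B(2)[of y] e by (simp add: abs_le_iff)
        qed
      qed simp
      then show ?thesis using glef[of k x] e by simp
    qed
    then show "\<exists>N. \<forall>k\<ge>N. norm (g k x - f x) < e" by blast
  qed
  ultimately show ?thesis using that glef gB by blast
qed

text \<open>Lipschitz minorants bound the integrals eventually from below, and the same bound for
  \<open>-f\<close> is the one from above. The filter is arbitrary so that real time and constant
  sequences are both covered.\<close>

lemma tendsto_integral_bcont_if_lipschitz:
  fixes M :: "'i \<Rightarrow> 'a::metric_space measure"
  assumes M: "eventually (\<lambda>i. prob_space (M i) \<and> sets (M i) = sets borel) F"
    and N: "prob_space N" "sets N = sets borel"
    and lip: "\<And>f. bounded_lipschitz f \<Longrightarrow> ((\<lambda>i. \<integral>x. f x \<partial>M i) \<longlongrightarrow> (\<integral>x. f x \<partial>N)) F"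
    and f: "bcont f"
  shows "((\<lambda>i. \<integral>x. f x \<partial>M i) \<longlongrightarrow> (\<integral>x. f x \<partial>N)) F"
proof -
  have lower: "eventually (\<lambda>i. (\<integral>x. h x \<partial>N) - e < (\<integral>x. h x \<partial>M i)) F"
    if h: "bcont h" and e: "e > 0" for h :: "'a \<Rightarrow> real" and e
  proof -
    obtain g B where g: "\<And>k::nat. bounded_lipschitz (g k)" "\<And>k x. g k x \<le> h x" "\<And>k x. \<bar>g k x\<bar> \<le> B"
      "\<And>x. (\<lambda>k. g k x) \<longlonglongrightarrow> h x"
      using bcont_lipschitz_approx[OF h] by blast
    have gm: "g k \<in> borel_measurable N" "h \<in> borel_measurable N" for k
      using g(1) h N(2) by (auto intro!: bcont_measurable bounded_lipschitz_bcont cong: measurable_cong_sets)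
    interpret N: prob_space N by (rule N)
    have "(\<lambda>k. \<integral>x. g k x \<partial>N) \<longlonglongrightarrow> (\<integral>x. h x \<partial>N)"
      using g by (intro integral_dominated_convergence[where w = "\<lambda>_. B"] gm) auto
    then have "eventually (\<lambda>k. (\<integral>x. h x \<partial>N) - e < (\<integral>x. g k x \<partial>N)) sequentially"
      using e by (intro order_tendstoD) auto
    then obtain k where k: "(\<integral>x. h x \<partial>N) - e < (\<integral>x. g k x \<partial>N)"
      by (auto simp: eventually_sequentially)
    have "eventually (\<lambda>i. (\<integral>x. h x \<partial>N) - e < (\<integral>x. g k x \<partial>M i)) F"
      by (rule order_tendstoD(1)[OF lip[OF g(1)] k])
    then show ?thesis
      using M
    proof eventually_elim
      case (elim i)
      have "(\<integral>x. g k x \<partial>M i) \<le> (\<integral>x. h x \<partial>M i)"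
        using elim(2) g(2) h bounded_lipschitz_bcont[OF g(1)] by (intro integral_mono bcont_integrable) auto
      then show ?case using elim(1) by simp
    qed
  qed
  show ?thesis
  proof (rule order_tendstoI)
    fix a assume "a < (\<integral>x. f x \<partial>N)"
    then show "eventually (\<lambda>i. a < (\<integral>x. f x \<partial>M i)) F"
      using lower[OF f, of "(\<integral>x. f x \<partial>N) - a"] by simp
  next
    fix a assume "(\<integral>x. f x \<partial>N) < a"
    then show "eventually (\<lambda>i. (\<integral>x. f x \<partial>M i) < a) F"
      using lower[OF bcont_mult[OF bcont_const[of "-1"] f], of "a - (\<integral>x. f x \<partial>N)"] by simp
  qed
qed

lemma open_bump_integral_tendsto:
  assumes P: "prob_space P" "sets P = sets borel" and U: "open U"
  shows "(\<lambda>n. \<integral>x. open_bump U n x \<partial>P) \<longlonglongrightarrow> measure P U"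
proof -
  interpret P: prob_space P by (rule P)
  have m: "open_bump U n \<in> borel_measurable P" for n
    using bcont_measurable[OF bcont_open_bump] P(2) by (auto cong: measurable_cong_sets)
  have Um: "U \<in> sets P" using U P by simp
  have "(\<lambda>n. open_bump U n x) \<longlonglongrightarrow> indicator U x" for x
  proof (cases "x \<in> U")
    case True then show ?thesis using open_bump_tendsto[OF U] by simp
  next
    case False
    then have "open_bump U n x = 0" for n
      using open_bump_nonneg[of U n x] open_bump_le_indicator[of U n x] by simp
    then show ?thesis using False by simp
  qed
  moreover have "\<bar>open_bump U n x\<bar> \<le> 1" for n x
    using open_bump_nonneg[of U n x] by (simp add: open_bump_def)
  ultimately have "(\<lambda>n. \<integral>x. open_bump U n x \<partial>P) \<longlonglongrightarrow> (\<integral>x. indicator U x \<partial>P)"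
    using Um m by (intro integral_dominated_convergence[where w = "\<lambda>_. 1"]) auto
  then show ?thesis using Um by simp
qed

lemma open_bump_integral_le:
  assumes P: "prob_space P" "sets P = sets borel" and U: "open U"
  shows "(\<integral>x. open_bump U n x \<partial>P) \<le> measure P U"
proof -
  interpret P: prob_space P by (rule P)
  have Um: "U \<in> sets P" using U P by simp
  have "(\<integral>x. open_bump U n x \<partial>P) \<le> (\<integral>x. indicator U x \<partial>P)"
    using Um by (intro integral_mono bcont_integrable[OF bcont_open_bump P] integrable_real_indicator)
      (auto simp: open_bump_le_indicator P.emeasure_eq_measure)
  then show ?thesis using Um by simp
qed

lemma open_bump_integral_pos:
  assumes P: "prob_space P" "sets P = sets borel" and U: "open U" and pos: "measure P U > 0"
  obtains n where "(\<integral>x. open_bump U n x \<partial>P) > 0"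
  using order_tendstoD(1)[OF open_bump_integral_tendsto[OF P U] pos]
  by (auto simp: eventually_sequentially)

text \<open>A constant sequence that converges on Lipschitz functions converges on all of
  \<open>bcont\<close>. Bumps then recover the measures of open sets, a generator stable under
  intersection.\<close>

lemma prob_measure_eqI_lipschitz:
  fixes M N :: "'a::metric_space measure"
  assumes M: "prob_space M" "sets M = sets borel" and N: "prob_space N" "sets N = sets borel"
    and lip: "\<And>f. bounded_lipschitz f \<Longrightarrow> (\<integral>x. f x \<partial>M) = (\<integral>x. f x \<partial>N)"
  shows "M = N"
proof -
  interpret M: prob_space M by (rule M)
  interpret N: prob_space N by (rule N)
  have eq: "(\<integral>x. f x \<partial>M) = (\<integral>x. f x \<partial>N)" if f: "bcont f" for f
  proof -
    have "((\<lambda>i::nat. \<integral>x. f x \<partial>M) \<longlongrightarrow> (\<integral>x. f x \<partial>N)) sequentially"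
      by (rule tendsto_integral_bcont_if_lipschitz) (use M N f lip in auto)
    then show ?thesis by (simp add: LIMSEQ_const_iff)
  qed
  have open_eq: "emeasure M U = emeasure N U" if U: "open U" for U
    using LIMSEQ_unique[OF open_bump_integral_tendsto[OF M U]] open_bump_integral_tendsto[OF N U] eq[OF bcont_open_bump]
    by (simp add: M.emeasure_eq_measure N.emeasure_eq_measure)
  show ?thesis
    by (rule measure_eqI_generator_eq[where E = "{U. open U}" and \<Omega> = UNIV and A = "\<lambda>_. UNIV"])
       (auto simp: M N sets_borel Int_stable_def open_eq)
qed

text \<open>Gliding hump: passing to a subset of indices makes the diagonal terms dominate both the
  earlier columns and the tails of their rows.\<close>

lemma phillips_diagonal:
  fixes a :: "nat \<Rightarrow> nat \<Rightarrow> real"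
  assumes summ: "\<And>i. summable (\<lambda>j. \<bar>a i j\<bar>)"
    and lim: "\<And>I. (\<lambda>i. \<Sum>j. indicator I j * a i j) \<longlonglongrightarrow> 0"
  shows "(\<lambda>i. a i i) \<longlonglongrightarrow> 0"
proof (rule ccontr)
  assume "\<not> ?thesis"
  then obtain e where e: "e > 0" "\<And>N. \<exists>i\<ge>N. e \<le> \<bar>a i i\<bar>"
    unfolding LIMSEQ_iff by (auto simp: not_less)
  \<comment> \<open>The hypothesis for singletons says that each column tends to 0.\<close>
  have col: "(\<lambda>i. a i j) \<longlonglongrightarrow> 0" for j
  proof -
    have "(\<Sum>l. indicator {j} l * a i l) = a i j" for i
      by (subst suminf_finite[of "{j}"]) auto
    then show ?thesis using lim[of "{j}"] by simp
  qed
  \<comment> \<open>The next index \<open>p'\<close> has a large diagonal entry and comes so late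
    that its row is small up to column \<open>p\<close>, and row \<open>p\<close> is small from
    column \<open>p'\<close> on.\<close>
  have step: "\<exists>p'. e \<le> \<bar>a p' p'\<bar> \<and> (p < p' \<and> (\<Sum>j\<le>p. \<bar>a p' j\<bar>) < e / 4 \<and> (\<Sum>j. \<bar>a p (j + p')\<bar>) < e / 4)" for p
  proof -
    have "(\<lambda>i. \<Sum>j\<le>p. \<bar>a i j\<bar>) \<longlonglongrightarrow> (\<Sum>j\<le>p. \<bar>0\<bar>)"
      by (intro tendsto_intros col)
    then have "eventually (\<lambda>i. (\<Sum>j\<le>p. \<bar>a i j\<bar>) < e / 4) sequentially"
      using e by (intro order_tendstoD) auto
    moreover have "eventually (\<lambda>i. (\<Sum>j. \<bar>a p (j + i)\<bar>) < e / 4) sequentially"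
      using suminf_exist_split2[OF summ[of p]] e by (intro order_tendstoD) auto
    moreover have "eventually (\<lambda>i. p < i) sequentially" by (rule eventually_gt_at_top)
    ultimately have "eventually (\<lambda>i. (\<Sum>j\<le>p. \<bar>a i j\<bar>) < e / 4 \<and> (\<Sum>j. \<bar>a p (j + i)\<bar>) < e / 4 \<and> p < i) sequentially"
      by eventually_elim auto
    then show ?thesis
      using e(2) unfolding eventually_sequentially by metis
  qed
  have "\<exists>r. \<forall>m. e \<le> \<bar>a (r m) (r m)\<bar> \<and> (r m < r (Suc m) \<and> (\<Sum>j\<le>r m. \<bar>a (r (Suc m)) j\<bar>) < e / 4
      \<and> (\<Sum>j. \<bar>a (r m) (j + r (Suc m))\<bar>) < e / 4)"
    by (rule dependent_nat_choice) (use e(2) step in auto)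
  then obtain r where r: "\<And>m. e \<le> \<bar>a (r m) (r m)\<bar>" "\<And>m. r m < r (Suc m)"
    "\<And>m. (\<Sum>j\<le>r m. \<bar>a (r (Suc m)) j\<bar>) < e / 4" "\<And>m. (\<Sum>j. \<bar>a (r m) (j + r (Suc m))\<bar>) < e / 4"
    by metis
  have mono: "strict_mono r" using r(2) by (rule strict_monoI_Suc)
  \<comment> \<open>In row \<open>r (Suc m)\<close> the set \<open>I\<close> only meets columns up
    to \<open>r m\<close>, the diagonal, and columns from \<open>r (Suc (Suc m))\<close> on. The
    outer two groups contribute less than \<open>e / 4\<close> each, against at least
    \<open>e\<close> on the diagonal.\<close>
  define I where "I = range r"
  have big: "e / 2 \<le> \<bar>\<Sum>j. indicator I j * a (r (Suc m)) j\<bar>" for m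
  proof -
    let ?p = "r (Suc m)" and ?q = "r (Suc (Suc m))"
    let ?b = "\<lambda>j. indicator I j * a ?p j"
    have sb: "summable (\<lambda>j. \<bar>?b j\<bar>)"
      by (rule summable_comparison_test[OF _ summ[of ?p]])
         (auto simp: abs_mult indicator_def intro!: exI[of _ 0])
    then have sb': "summable ?b" by (rule summable_rabs_cancel)
    have z1: "?b j = 0" if "r m < j" "j < ?p" for j
    proof -
      have "j \<notin> I"
        using that strict_mono_less[OF mono] by (auto simp: I_def)
      then show ?thesis by simp
    qed
    have z2: "?b j = 0" if "?p < j" "j < ?q" for j
    proof -
      have "j \<notin> I"
        using that strict_mono_less[OF mono] by (auto simp: I_def)
      then show ?thesis by simp
    qed
    have "(\<Sum>j. ?b j) = (\<Sum>j. ?b (j + ?q)) + (\<Sum>j<?q. ?b j)"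
      by (rule suminf_split_initial_segment[OF sb'])
    also have "(\<Sum>j<?q. ?b j) = (\<Sum>j\<in>{..r m} \<union> {?p}. ?b j)"
    proof (rule sum.mono_neutral_right)
      show "{..r m} \<union> {?p} \<subseteq> {..<?q}" using r(2)[of m] r(2)[of "Suc m"] by auto
      show "\<forall>j\<in>{..<?q} - ({..r m} \<union> {?p}). ?b j = 0"
        using z1 z2 by (metis DiffD1 DiffD2 UnCI atMost_iff insertCI lessThan_iff linorder_neqE_nat not_le)
    qed simp
    also have "\<dots> = (\<Sum>j\<le>r m. ?b j) + a ?p ?p"
      using r(2)[of m] by (subst sum.union_disjoint) (auto simp: I_def)
    finally have eq: "(\<Sum>j. ?b j) = (\<Sum>j. ?b (j + ?q)) + (\<Sum>j\<le>r m. ?b j) + a ?p ?p" by simp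
    have "\<bar>\<Sum>j. ?b (j + ?q)\<bar> \<le> (\<Sum>j. \<bar>?b (j + ?q)\<bar>)"
      by (rule summable_rabs, subst summable_iff_shift[of "\<lambda>j. \<bar>?b j\<bar>"]) (rule sb)
    also have "\<dots> \<le> (\<Sum>j. \<bar>a ?p (j + ?q)\<bar>)"
    proof (rule suminf_le)
      show "\<bar>?b (j + ?q)\<bar> \<le> \<bar>a ?p (j + ?q)\<bar>" for j by (auto simp: indicator_def)
      show "summable (\<lambda>j. \<bar>?b (j + ?q)\<bar>)"
        using sb by (subst summable_iff_shift[of "\<lambda>j. \<bar>?b j\<bar>"])
      show "summable (\<lambda>j. \<bar>a ?p (j + ?q)\<bar>)"
        using summ[of ?p] by (subst summable_iff_shift[of "\<lambda>j. \<bar>a ?p j\<bar>"])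
    qed
    also have "\<dots> < e / 4" by (rule r(4))
    finally have t: "\<bar>\<Sum>j. ?b (j + ?q)\<bar> < e / 4" .
    have "\<bar>\<Sum>j\<le>r m. ?b j\<bar> \<le> (\<Sum>j\<le>r m. \<bar>?b j\<bar>)" by (rule sum_abs)
    also have "\<dots> \<le> (\<Sum>j\<le>r m. \<bar>a ?p j\<bar>)" by (intro sum_mono) (auto simp: indicator_def)
    also have "\<dots> < e / 4" by (rule r(3))
    finally show ?thesis using t eq r(1)[of "Suc m"] by linarith
  qed
  have "eventually (\<lambda>i. \<bar>\<Sum>j. indicator I j * a i j\<bar> < e / 2) sequentially"
    using tendsto_rabs[OF lim[of I]] e by (intro order_tendstoD) auto
  then obtain N where N: "\<And>i. i \<ge> N \<Longrightarrow> \<bar>\<Sum>j. indicator I j * a i j\<bar> < e / 2"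
    by (auto simp: eventually_sequentially)
  have "N \<le> r (Suc N)" using strict_mono_imp_increasing[OF mono, of "Suc N"] by simp
  then show False using N big[of N] by fastforce
qed

section \<open>Merging of orbits\<close>

lemma Limsup_eq_0_eventually_less:
  fixes f :: "'b \<Rightarrow> ereal"
  assumes "Limsup F f = 0" "0 < e"
  shows "eventually (\<lambda>x. f x < e) F"
  using assms by (intro Limsup_lessD) simp

lemma eventually_at_top_shift:
  fixes T :: real
  assumes "eventually (\<lambda>t. R (T + t)) at_top"
  shows "eventually R at_top"
proof -
  obtain N where "\<And>t. t \<ge> N \<Longrightarrow> R (T + t)" using assms by (auto simp: eventually_at_top_linorder)
  then have "R t" if "t \<ge> T + N" for t using that by (metis add_diff_cancel_left' diff_add_cancel add.commute diff_ge_0_iff_ge le_diff_eq)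
  then show ?thesis by (auto simp: eventually_at_top_linorder)
qed

lemma prob_algebraD:
  assumes "\<nu> \<in> space (prob_algebra borel)"
  shows "prob_space \<nu>" "sets \<nu> = sets borel" "space \<nu> = UNIV"
  using assms sets_eq_imp_space_eq[of \<nu> borel] by (auto simp: space_prob_algebra)

text \<open>\<open>m1\<close> is \<open>m\<close> conditioned on \<open>B\<close> and
  \<open>m2\<close> is the normalized rest, whose density is nonnegative since
  \<open>c \<le> measure m B\<close>. The weight is a prescribed \<open>c\<close> rather than the
  mass of \<open>B\<close>, so that two laws can be split with equal weights.\<close>

lemma prob_measure_split:
  assumes m: "m \<in> space (prob_algebra borel)" and B: "B \<in> sets borel"
    and c: "0 < c" "c < 1" "c \<le> measure m B"
  obtains m1 m2 where "m1 \<in> space (prob_algebra borel)" "m2 \<in> space (prob_algebra borel)"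
    "AE x in m1. x \<in> B"
    "\<And>f. bcont f \<Longrightarrow> (\<integral>x. f x \<partial>m) = c * (\<integral>x. f x \<partial>m1) + (1 - c) * (\<integral>x. f x \<partial>m2)"
proof -
  interpret prob_space m by (rule prob_algebraD[OF m])
  note sets = prob_algebraD(2)[OF m] and space = prob_algebraD(3)[OF m]
  define p where "p = measure m B"
  have p: "p > 0" "c \<le> p" using c by (auto simp: p_def)
  have Bm: "B \<in> sets m" using B sets by simp
  define d1 :: "'a \<Rightarrow> real" where "d1 x = indicator B x / p" for x
  define d2 :: "'a \<Rightarrow> real" where "d2 x = (1 - c * d1 x) / (1 - c)" for x
  have d1: "d1 \<in> borel_measurable m" unfolding d1_def using Bm by measurable
  have d2: "d2 \<in> borel_measurable m" unfolding d2_def using d1 by measurable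
  have d1n: "d1 x \<ge> 0" for x using p by (simp add: d1_def)
  have d2n: "d2 x \<ge> 0" for x using p c by (auto simp: d2_def d1_def indicator_def field_simps)
  have i1: "integrable m d1" unfolding d1_def using Bm by (intro integrable_divide integrable_real_indicator) (auto simp: emeasure_eq_measure)
  have i2: "integrable m d2" unfolding d2_def using i1 by auto
  have e1: "(\<integral>x. d1 x \<partial>m) = 1" using Bm p by (simp add: d1_def p_def)
  have e2: "(\<integral>x. d2 x \<partial>m) = 1"
    unfolding d2_def using i1 e1 c prob_space by simp
  have pr: "density m (\<lambda>x. ennreal (d x)) \<in> space (prob_algebra borel)"
    if "integrable m d" "\<And>x. d x \<ge> 0" "(\<integral>x. d x \<partial>m) = 1" for d
  proof -
    have "emeasure (density m (\<lambda>x. ennreal (d x))) (space m) = (\<integral>\<^sup>+x. ennreal (d x) \<partial>m)"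
      using borel_measurable_integrable[OF that(1)]
      by (subst emeasure_density) (auto intro!: nn_integral_cong)
    also have "\<dots> = 1" using that by (subst nn_integral_eq_integral) auto
    finally show ?thesis
      by (auto simp: space_prob_algebra sets intro!: prob_spaceI)
  qed
  have ae: "AE x in density m (\<lambda>x. ennreal (d1 x)). x \<in> B"
    using d1 by (subst AE_density) (simp, auto simp: d1_def indicator_def)
  have eq: "(\<integral>x. f x \<partial>m) = c * (\<integral>x. f x \<partial>density m (\<lambda>x. ennreal (d1 x)))
      + (1 - c) * (\<integral>x. f x \<partial>density m (\<lambda>x. ennreal (d2 x)))" if f: "bcont f" for f :: "'a \<Rightarrow> real"
  proof -
    have fm: "f \<in> borel_measurable m"
      using bcont_measurable[OF f] sets by (simp cong: measurable_cong_sets)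
    obtain C where C: "\<And>x. \<bar>f x\<bar> \<le> C" using bcont_bound[OF f] by blast
    have j: "integrable m (\<lambda>x. d x * f x)" if "integrable m d" for d
    proof (rule Bochner_Integration.integrable_bound)
      show "integrable m (\<lambda>x. C * d x)" using that by simp
      show "(\<lambda>x. d x * f x) \<in> borel_measurable m"
        using fm borel_measurable_integrable[OF that] by simp
      have "\<bar>d x * f x\<bar> \<le> \<bar>C * d x\<bar>" for x
        unfolding abs_mult using mult_right_mono[of "\<bar>f x\<bar>" "\<bar>C\<bar>" "\<bar>d x\<bar>"] C[of x]
        by (simp add: mult.commute)
      then show "AE x in m. norm (d x * f x) \<le> norm (C * d x)" by simp
    qed
    have "c * (\<integral>x. d1 x * f x \<partial>m) + (1 - c) * (\<integral>x. d2 x * f x \<partial>m)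
        = (\<integral>x. c * (d1 x * f x) + (1 - c) * (d2 x * f x) \<partial>m)"
      using j[OF i1] j[OF i2] by simp
    also have "\<dots> = (\<integral>x. f x \<partial>m)"
    proof (intro Bochner_Integration.integral_cong refl)
      fix x
      have "(1 - c) * (d2 x * f x) = ((1 - c) * d2 x) * f x" by simp
      also have "(1 - c) * d2 x = 1 - c * d1 x" using c by (simp add: d2_def)
      finally show "c * (d1 x * f x) + (1 - c) * (d2 x * f x) = f x" by (simp add: algebra_simps)
    qed
    finally show ?thesis
      using fm d1 d2 d1n d2n by (simp add: integral_density)
  qed
  show ?thesis
    by (rule that[OF pr[OF i1 d1n e1] pr[OF i2 d2n e2] ae eq])
qed

section \<open>Action of the semigroup on laws and on functions\<close>

locale markov_feller =
  fixes K :: "real \<Rightarrow> 'a::polish_space \<Rightarrow> 'a measure"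
  assumes markov_feller: "markov_feller_semigroup K"
begin

abbreviation pr :: "'a measure \<Rightarrow> bool" where
  "pr \<nu> \<equiv> \<nu> \<in> space (prob_algebra borel)"

definition P :: "real \<Rightarrow> ('a \<Rightarrow> real) \<Rightarrow> 'a \<Rightarrow> real" where
  "P t f x = (\<integral>y. f y \<partial>K t x)"

lemma kernel: "t \<ge> 0 \<Longrightarrow> K t \<in> borel \<rightarrow>\<^sub>M prob_algebra borel"
  using markov_feller by (auto simp: markov_feller_semigroup_def)

lemma kernel_subprob: "t \<ge> 0 \<Longrightarrow> K t \<in> borel \<rightarrow>\<^sub>M subprob_algebra borel"
  by (intro measurable_prob_algebraD kernel)

lemma pr_kernel: "t \<ge> 0 \<Longrightarrow> pr (K t x)"
  using measurable_space[OF kernel, of t x] by simp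

lemma pr_bind: "t \<ge> 0 \<Longrightarrow> pr \<nu> \<Longrightarrow> pr (\<nu> \<bind> K t)"
  using prob_space_bind'[OF _ kernel] sets_bind'[OF _ kernel] by (auto simp: space_prob_algebra)

lemma pr_return: "pr (return borel x)"
  by (simp add: space_prob_algebra prob_space_return)

lemma return_bind: "t \<ge> 0 \<Longrightarrow> return borel x \<bind> K t = K t x"
  by (intro bind_return[OF kernel_subprob]) auto

lemma bcont_integrable_pr: "pr \<nu> \<Longrightarrow> bcont f \<Longrightarrow> integrable \<nu> f"
  by (intro bcont_integrable prob_algebraD)

lemma abs_integral_le:
  fixes f :: "'a \<Rightarrow> real"
  assumes \<nu>: "pr \<nu>" and f: "f \<in> borel_measurable borel" "\<And>x. \<bar>f x\<bar> \<le> B"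
  shows "\<bar>\<integral>x. f x \<partial>\<nu>\<bar> \<le> B"
proof -
  interpret prob_space \<nu> by (rule prob_algebraD[OF \<nu>])
  have "integrable \<nu> f"
    using f prob_algebraD(2)[OF \<nu>]
    by (intro integrable_const_bound[where B = B]) (auto cong: measurable_cong_sets)
  then have "(\<integral>x. \<bar>f x\<bar> \<partial>\<nu>) \<le> B"
    using f(2) by (intro integral_le_const) auto
  then show ?thesis by (rule order_trans[OF integral_abs_bound])
qed

lemma bcont_P: 
  assumes t: "t \<ge> 0" and f: "bcont f"
  shows "bcont (P t f)"
proof -
  obtain B where B: "\<And>x. \<bar>f x\<bar> \<le> B" using bcont_bound[OF f] by blast
  have "continuous_on UNIV (P t f)"
    using markov_feller t f unfolding markov_feller_semigroup_def bcont_def P_def[abs_def] by blast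
  then show ?thesis
    unfolding P_def[abs_def]
    by (rule bcontI) (rule abs_integral_le[OF pr_kernel[OF t] bcont_measurable[OF f] B])
qed

lemma P_bound:
  assumes "t \<ge> 0" "bcont f" "\<And>x. \<bar>f x\<bar> \<le> B"
  shows "\<bar>P t f x\<bar> \<le> B"
  unfolding P_def using assms by (intro abs_integral_le pr_kernel bcont_measurable)

lemma integral_bind_P:
  assumes t: "t \<ge> 0" and \<nu>: "pr \<nu>" and f: "bcont f"
  shows "(\<integral>x. f x \<partial>(\<nu> \<bind> K t)) = (\<integral>x. P t f x \<partial>\<nu>)"
proof -
  obtain B where B: "\<And>x. \<bar>f x\<bar> \<le> B" using bcont_bound[OF f] by blast
  interpret prob_space \<nu> by (rule prob_algebraD[OF \<nu>])
  have "K t \<in> \<nu> \<rightarrow>\<^sub>M subprob_algebra borel"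
    using kernel_subprob[OF t] prob_algebraD(2)[OF \<nu>] by (simp cong: measurable_cong_sets)
  then show ?thesis
    unfolding P_def
    using bcont_measurable[OF f] B prob_space.emeasure_space_1[OF prob_algebraD(1)[OF pr_kernel[OF t]]]
    by (intro integral_bind[where K = borel and B = B and B' = 1]) (auto intro: finite_measure_axioms)
qed

lemma measure_bind_kernel:
  assumes t: "t \<ge> 0" and \<nu>: "pr \<nu>" and A: "A \<in> sets borel"
  shows "measure (\<nu> \<bind> K t) A = (\<integral>x. measure (K t x) A \<partial>\<nu>)"
proof -
  interpret prob_space \<nu> by (rule prob_algebraD[OF \<nu>])
  interpret K: prob_space "K t x" for x by (rule prob_algebraD[OF pr_kernel[OF t]])
  have m: "K t \<in> \<nu> \<rightarrow>\<^sub>M subprob_algebra borel"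
    using kernel_subprob[OF t] prob_algebraD(2)[OF \<nu>] by (simp cong: measurable_cong_sets)
  have "measure (\<nu> \<bind> K t) A = (\<integral>y. indicator A y \<partial>(\<nu> \<bind> K t))"
    using A prob_algebraD(2)[OF pr_bind[OF t \<nu>]] by simp
  also have "\<dots> = (\<integral>x. (\<integral>y. indicator A y \<partial>K t x) \<partial>\<nu>)"
    using A m K.emeasure_space_1
    by (intro integral_bind[where K = borel and B = 1 and B' = 1])
       (auto simp: indicator_def intro: finite_measure_axioms)
  finally show ?thesis
    using A prob_algebraD(2)[OF pr_kernel[OF t]] by simp
qed

lemma measurable_measure_kernel:
  "t \<ge> 0 \<Longrightarrow> A \<in> sets borel \<Longrightarrow> (\<lambda>x. measure (K t x) A) \<in> borel_measurable borel"
  by (rule measurable_compose[OF kernel_subprob measurable_measure_subprob_algebra])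

lemma bind_add:
  assumes "s \<ge> 0" "t \<ge> 0" and \<nu>: "pr \<nu>"
  shows "\<nu> \<bind> K (s + t) = \<nu> \<bind> K s \<bind> K t"
proof -
  have m: "K s \<in> \<nu> \<rightarrow>\<^sub>M subprob_algebra borel"
    using kernel_subprob[OF assms(1)] prob_algebraD(2)[OF \<nu>] by (simp cong: measurable_cong_sets)
  have "K (s + t) = (\<lambda>x. K s x \<bind> K t)"
    using markov_feller assms by (auto simp: markov_feller_semigroup_def)
  then show ?thesis
    using bind_assoc[OF m kernel_subprob[OF assms(2)]] by simp
qed

lemma kernel_add: "s \<ge> 0 \<Longrightarrow> t \<ge> 0 \<Longrightarrow> K (s + t) x = K s x \<bind> K t"
  using markov_feller by (auto simp: markov_feller_semigroup_def)

text \<open>The waiting time in \<open>near\<close> depends on \<open>x\<close>. The excess over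
  \<open>\<eta>\<close> is bounded and tends to 0 pointwise on \<open>B\<close>, so by dominated
  convergence its mean over \<open>m\<close> is small from one common time on.\<close>

lemma eventually_integral_near:
  assumes m: "pr m" and f: "bcont f" and ae: "AE x in m. x \<in> B"
    and near: "\<forall>x\<in>B. eventually (\<lambda>t. \<bar>P t f x - P t f z\<bar> < \<eta>) at_top"
    and e: "e > 0"
  shows "eventually (\<lambda>t. \<bar>(\<integral>x. P t f x \<partial>m) - P t f z\<bar> < \<eta> + e) at_top"
proof -
  interpret prob_space m by (rule prob_algebraD[OF m])
  obtain C where C: "C > 0" "\<And>x. \<bar>f x\<bar> \<le> C" using bcont_bound[OF f] by blast
  \<comment> \<open>\<open>K t\<close> is constrained only for \<open>t \<ge> 0\<close>; clamping
    the time makes \<open>g t\<close> measurable and bounded for every real \<open>t\<close>, as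
    dominated convergence along \<open>at_top\<close> requires.\<close>
  let ?s = "\<lambda>t::real. max t 0"
  define g where "g t x = max 0 (\<bar>P (?s t) f x - P (?s t) f z\<bar> - \<eta>)" for t x
  have Pb: "bcont (P (?s t) f)" for t by (intro bcont_P f) simp
  have gm: "g t \<in> borel_measurable m" for t
    using bcont_measurable[OF Pb] prob_algebraD(2)[OF m]
    unfolding g_def by (simp cong: measurable_cong_sets)
  have bound: "norm (g t x) \<le> 2 * C + \<bar>\<eta>\<bar>" for t x
    using P_bound[OF _ f C(2), of "?s t" x] P_bound[OF _ f C(2), of "?s t" z] C(1)
    unfolding g_def real_norm_def by linarith
  have lim: "((\<lambda>t. g t x) \<longlongrightarrow> 0) at_top" if "x \<in> B" for x
  proof (rule tendsto_eventually)
    show "eventually (\<lambda>t. g t x = 0) at_top"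
      using near[rule_format, OF that] eventually_ge_at_top[of 0]
      by eventually_elim (simp add: g_def)
  qed
  have "((\<lambda>t. \<integral>x. g t x \<partial>m) \<longlongrightarrow> (\<integral>x. 0 \<partial>m)) at_top"
    using ae lim bound gm by (intro integral_dominated_convergence_at_top[where w = "\<lambda>_. 2 * C + \<bar>\<eta>\<bar>"] gm)
      (use bound lim in auto)
  then have "eventually (\<lambda>t. (\<integral>x. g t x \<partial>m) < e) at_top"
    using e by (intro order_tendstoD) auto
  then show ?thesis
    using eventually_ge_at_top[of 0]
  proof eventually_elim
    case (elim t)
    have st: "?s t = t" using elim by simp
    have ig: "integrable m (g t)"
      using bound gm by (intro integrable_const_bound[where B = "2 * C + \<bar>\<eta>\<bar>"]) auto
    have iP: "integrable m (\<lambda>x. P t f x - P t f z)"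
      using Pb[of t] unfolding st by (intro bcont_integrable_pr[OF m] bcont_diff) auto
    have "\<bar>(\<integral>x. P t f x \<partial>m) - P t f z\<bar> = \<bar>\<integral>x. P t f x - P t f z \<partial>m\<bar>"
      using bcont_integrable_pr[OF m Pb[of t]] prob_space unfolding st by simp
    also have "\<dots> \<le> (\<integral>x. \<bar>P t f x - P t f z\<bar> \<partial>m)"
      by (rule integral_abs_bound)
    also have "\<dots> \<le> (\<integral>x. \<eta> + g t x \<partial>m)"
      using ig iP by (intro integral_mono) (auto simp: g_def st)
    also have "\<dots> = \<eta> + (\<integral>x. g t x \<partial>m)" using ig prob_space by simp
    finally show ?case using elim by simp
  qed
qed

text \<open>The device of \<open>eventually_integral_near\<close>, applied to the shortfall below
  \<open>c\<close>; the gap between \<open>c'\<close> and \<open>c\<close> absorbs its mean.\<close>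

lemma eventually_bind_ge:
  assumes \<nu>: "pr \<nu>" and A: "A \<in> sets borel"
    and low: "\<And>x. eventually (\<lambda>t. c < measure (K t x) A) at_top" and c': "c' < c"
  shows "eventually (\<lambda>t. c' \<le> measure (\<nu> \<bind> K t) A) at_top"
proof -
  interpret prob_space \<nu> by (rule prob_algebraD[OF \<nu>])
  let ?s = "\<lambda>t::real. max t 0"
  define g where "g t x = max 0 (c - measure (K (?s t) x) A)" for t x
  have Km: "(\<lambda>x. measure (K (?s t) x) A) \<in> borel_measurable \<nu>" for t
    using measurable_measure_kernel[of "?s t", OF _ A] prob_algebraD(2)[OF \<nu>]
    by (simp cong: measurable_cong_sets)
  then have gm: "g t \<in> borel_measurable \<nu>" for t
    unfolding g_def by measurable
  have bound: "norm (g t x) \<le> \<bar>c\<bar>" for t x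
    unfolding g_def real_norm_def using measure_nonneg[of "K (?s t) x" A] by linarith
  have lim: "((\<lambda>t. g t x) \<longlongrightarrow> 0) at_top" for x
  proof (rule tendsto_eventually)
    show "eventually (\<lambda>t. g t x = 0) at_top"
      using low[of x] eventually_ge_at_top[of 0]
      by eventually_elim (simp add: g_def)
  qed
  have "((\<lambda>t. \<integral>x. g t x \<partial>\<nu>) \<longlongrightarrow> (\<integral>x. 0 \<partial>\<nu>)) at_top"
    by (intro integral_dominated_convergence_at_top[where w = "\<lambda>_. \<bar>c\<bar>"] gm)
      (use bound lim in auto)
  then have "eventually (\<lambda>t. (\<integral>x. g t x \<partial>\<nu>) < c - c') at_top"
    using c' by (intro order_tendstoD) auto
  then show ?thesis
    using eventually_ge_at_top[of 0]
  proof eventually_elim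
    case (elim t)
    have st: "?s t = t" using elim by simp
    have ig: "integrable \<nu> (g t)"
      using bound gm by (intro integrable_const_bound[where B = "\<bar>c\<bar>"]) auto
    have iK: "integrable \<nu> (\<lambda>x. measure (K t x) A)"
      using Km[of t] prob_space.prob_le_1[OF prob_algebraD(1)[OF pr_kernel[OF elim(2)]]]
      unfolding st by (intro integrable_const_bound[where B = 1]) auto
    have "c = (\<integral>x. c \<partial>\<nu>)" using prob_space by simp
    also have "\<dots> \<le> (\<integral>x. measure (K t x) A + g t x \<partial>\<nu>)"
      using ig iK by (intro integral_mono) (auto simp: g_def st)
    also have "\<dots> = measure (\<nu> \<bind> K t) A + (\<integral>x. g t x \<partial>\<nu>)"
      using ig iK measure_bind_kernel[OF elim(2) \<nu> A] by simp
    finally show ?case using elim by simp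
  qed
qed

end

section \<open>Contraction of the asymptotic discrepancy\<close>

locale eventually_continuous_semigroup = markov_feller K
  for K :: "real \<Rightarrow> 'a::polish_space \<Rightarrow> 'a measure" +
  fixes z :: 'a
  assumes ev_cont: "eventually_continuous_at K z"
    and lower_bound: "lower_bound_cond K z"
begin

text \<open>The outer limsup yields a radius common to all \<open>x\<close>, the inner one only a
  waiting time that depends on \<open>x\<close>.\<close>

lemma ev_cont_ball:
  assumes f: "bounded_lipschitz f" and \<eta>: "\<eta> > 0"
  obtains e where "e > 0"
    "\<And>x. x \<in> ball z e \<Longrightarrow> eventually (\<lambda>t. \<bar>P t f x - P t f z\<bar> < \<eta>) at_top"
proof -
  have "Limsup (nhds z) (\<lambda>x. Limsup at_top (\<lambda>t. ereal \<bar>P t f x - P t f z\<bar>)) = 0"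
    using ev_cont f unfolding eventually_continuous_at_def bounded_lipschitz_def P_def by blast
  from Limsup_eq_0_eventually_less[OF this, of "ereal \<eta>"] \<eta>
  obtain e where "e > 0"
    and e: "\<And>x. dist x z < e \<Longrightarrow> Limsup at_top (\<lambda>t. ereal \<bar>P t f x - P t f z\<bar>) < ereal \<eta>"
    by (auto simp: eventually_nhds_metric)
  have "eventually (\<lambda>t. \<bar>P t f x - P t f z\<bar> < \<eta>) at_top" if "x \<in> ball z e" for x
    using Limsup_lessD[OF e[of x]] that by (simp add: dist_commute)
  with \<open>e > 0\<close> show ?thesis by (rule that)
qed

lemma lower_bound_ball:
  assumes e: "e > 0"
  obtains c where "c > 0" "\<And>x. eventually (\<lambda>t. c < measure (K t x) (ball z e)) at_top"
proof -
  have "0 < (INF x. Liminf at_top (\<lambda>t. ereal (measure (K t x) (ball z e))))"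
    using lower_bound e by (auto simp: lower_bound_cond_def)
  then obtain c where c: "0 < ereal c"
      "ereal c < (INF x. Liminf at_top (\<lambda>t. ereal (measure (K t x) (ball z e))))"
    using ereal_dense2 by blast
  have "eventually (\<lambda>t. c < measure (K t x) (ball z e)) at_top" for x
  proof -
    have "ereal c < Liminf at_top (\<lambda>t. ereal (measure (K t x) (ball z e)))"
      using c(2) by (rule less_le_trans) (auto intro: INF_lower)
    from less_LiminfD[OF this] show ?thesis by simp
  qed
  with c show ?thesis by (intro that) auto
qed

text \<open>An upper bound for the largest asymptotic discrepancy. Asking for every
  \<open>d' > d\<close> makes the property pass to infima of \<open>d\<close>; ranging over all
  pairs of laws lets it be applied to the remainders of a splitting.\<close>

definition merges_within :: "('a \<Rightarrow> real) \<Rightarrow> real \<Rightarrow> bool" where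
  "merges_within f d \<longleftrightarrow> (\<forall>\<nu>1 \<nu>2 d'. pr \<nu>1 \<longrightarrow> pr \<nu>2 \<longrightarrow> d < d' \<longrightarrow>
     eventually (\<lambda>t. \<bar>(\<integral>x. P t f x \<partial>\<nu>1) - (\<integral>x. P t f x \<partial>\<nu>2)\<bar> < d') at_top)"

lemma integral_P_add:
  assumes "s \<ge> 0" "t \<ge> 0" "pr \<nu>" "bcont f"
  shows "(\<integral>x. P (s + t) f x \<partial>\<nu>) = (\<integral>x. P t f x \<partial>(\<nu> \<bind> K s))"
  using assms by (simp add: integral_bind_P[symmetric] bind_add pr_bind)

lemma merges_within_contract:
  assumes f: "bounded_lipschitz f" and \<eta>: "\<eta> > 0"
  obtains c where "0 < c" "c < 1"
    "\<And>d. merges_within f d \<Longrightarrow> merges_within f (c * (2 * \<eta>) + (1 - c) * d)"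
proof -
  note fb = bounded_lipschitz_bcont[OF f]
  obtain e where e: "e > 0"
    "\<forall>x\<in>ball z e. eventually (\<lambda>t. \<bar>P t f x - P t f z\<bar> < \<eta>) at_top"
    by (rule ev_cont_ball[OF f \<eta>]) blast
  obtain c0 where c0: "c0 > 0" "\<And>x. eventually (\<lambda>t. c0 < measure (K t x) (ball z e)) at_top"
    by (rule lower_bound_ball[OF e(1)]) blast
  \<comment> \<open>Halving \<open>c0\<close> leaves the gap demanded by
    \<open>eventually_bind_ge\<close>, and the cap \<open>1 / 2\<close> gives the
    \<open>c < 1\<close> demanded by the splitting. The choice of \<open>c\<close> precedes
    \<open>d\<close>.\<close>
  define c where "c = min (c0 / 2) (1 / 2)"
  have c: "0 < c" "c < 1" "c < c0" using c0(1) by (auto simp: c_def)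
  have "merges_within f (c * (2 * \<eta>) + (1 - c) * d)" if d: "merges_within f d" for d
    unfolding merges_within_def
  proof (intro allI impI)
    fix \<nu>1 \<nu>2 :: "'a measure" and d'
    assume \<nu>: "pr \<nu>1" "pr \<nu>2" and d': "c * (2 * \<eta>) + (1 - c) * d < d'"
    \<comment> \<open>Half of the available slack. Each of the two comparisons with
      \<open>P t f z\<close> may spend \<open>r / 2\<close> and the remainders may spend
      \<open>r\<close>; weighted by \<open>c\<close> and \<open>1 - c\<close> this totals
      \<open>r\<close>.\<close>
    define r where "r = (d' - (c * (2 * \<eta>) + (1 - c) * d)) / 2"
    have r: "r > 0" using d' by (simp add: r_def)
    have "eventually (\<lambda>t. c \<le> measure (\<nu>1 \<bind> K t) (ball z e) \<and> c \<le> measure (\<nu>2 \<bind> K t) (ball z e) \<and> t \<ge> 0) at_top"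
      using c by (intro eventually_conj eventually_bind_ge[OF _ _ c0(2)] eventually_ge_at_top \<nu>) auto
    then obtain T where T: "c \<le> measure (\<nu>1 \<bind> K T) (ball z e)" "c \<le> measure (\<nu>2 \<bind> K T) (ball z e)" "T \<ge> 0"
      by (auto simp: eventually_at_top_linorder)
    obtain a1 a2 where a: "pr a1" "pr a2" "AE x in a1. x \<in> ball z e"
      "\<And>f. bcont f \<Longrightarrow> (\<integral>x. f x \<partial>(\<nu>1 \<bind> K T)) = c * (\<integral>x. f x \<partial>a1) + (1 - c) * (\<integral>x. f x \<partial>a2)"
      by (rule prob_measure_split[OF pr_bind[OF T(3) \<nu>(1)] _ c(1,2) T(1)]) auto
    obtain b1 b2 where b: "pr b1" "pr b2" "AE x in b1. x \<in> ball z e"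
      "\<And>f. bcont f \<Longrightarrow> (\<integral>x. f x \<partial>(\<nu>2 \<bind> K T)) = c * (\<integral>x. f x \<partial>b1) + (1 - c) * (\<integral>x. f x \<partial>b2)"
      by (rule prob_measure_split[OF pr_bind[OF T(3) \<nu>(2)] _ c(1,2) T(2)]) auto
    have r2: "r / 2 > 0" and dr: "d < d + r" using r by auto
    have "eventually (\<lambda>t. \<bar>(\<integral>x. P (T + t) f x \<partial>\<nu>1) - (\<integral>x. P (T + t) f x \<partial>\<nu>2)\<bar> < d') at_top"
      using eventually_integral_near[OF a(1) fb a(3) e(2) r2] eventually_integral_near[OF b(1) fb b(3) e(2) r2]
        d[unfolded merges_within_def, rule_format, OF a(2) b(2) dr] eventually_ge_at_top[of 0]
    proof eventually_elim
      case (elim t)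
      let ?A1 = "\<integral>x. P t f x \<partial>a1" and ?A2 = "\<integral>x. P t f x \<partial>a2"
        and ?B1 = "\<integral>x. P t f x \<partial>b1" and ?B2 = "\<integral>x. P t f x \<partial>b2"
      note Pb = bcont_P[OF elim(4) fb]
      have eq: "(\<integral>x. P (T + t) f x \<partial>\<nu>1) - (\<integral>x. P (T + t) f x \<partial>\<nu>2)
          = c * (?A1 - ?B1) + (1 - c) * (?A2 - ?B2)"
        unfolding integral_P_add[OF T(3) elim(4) \<nu>(1) fb] integral_P_add[OF T(3) elim(4) \<nu>(2) fb]
          a(4)[OF Pb] b(4)[OF Pb] by (simp add: right_diff_distrib)
      have "\<bar>c * (?A1 - ?B1) + (1 - c) * (?A2 - ?B2)\<bar> \<le> \<bar>c * (?A1 - ?B1)\<bar> + \<bar>(1 - c) * (?A2 - ?B2)\<bar>"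
        by (rule abs_triangle_ineq)
      also have "\<dots> = c * \<bar>?A1 - ?B1\<bar> + (1 - c) * \<bar>?A2 - ?B2\<bar>"
        using c by (simp add: abs_mult)
      also have "\<dots> < c * (2 * \<eta> + r) + (1 - c) * (d + r)"
      proof (rule add_strict_mono)
        have "\<bar>?A1 - ?B1\<bar> < 2 * \<eta> + r" using elim(1,2) by linarith
        then show "c * \<bar>?A1 - ?B1\<bar> < c * (2 * \<eta> + r)" using c by simp
        show "(1 - c) * \<bar>?A2 - ?B2\<bar> < (1 - c) * (d + r)" using elim(3) c by simp
      qed
      also have "\<dots> = (c * (2 * \<eta>) + (1 - c) * d) + r" by (simp add: algebra_simps)
      also have "\<dots> < d'"
        using d' less_half_sum[of "c * (2 * \<eta>) + (1 - c) * d" d'] by (simp add: r_def field_simps)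
      finally show ?case by (simp only: eq)
    qed
    then show "eventually (\<lambda>t. \<bar>(\<integral>x. P t f x \<partial>\<nu>1) - (\<integral>x. P t f x \<partial>\<nu>2)\<bar> < d') at_top"
      by (rule eventually_at_top_shift)
  qed
  with c show ?thesis by (intro that) auto
qed

lemma merges:
  assumes f: "bounded_lipschitz f" and \<nu>: "pr \<nu>1" "pr \<nu>2"
  shows "((\<lambda>t. (\<integral>x. P t f x \<partial>\<nu>1) - (\<integral>x. P t f x \<partial>\<nu>2)) \<longlongrightarrow> 0) at_top"
proof -
  note fb = bounded_lipschitz_bcont[OF f]
  define D where "D = {d. d \<ge> 0 \<and> merges_within f d}"
  obtain B where B: "B > 0" "\<And>x. \<bar>f x\<bar> \<le> B" using bcont_bound[OF fb] by blast
  have "2 * B \<in> D"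
  proof -
    have "eventually (\<lambda>t. \<bar>(\<integral>x. P t f x \<partial>\<nu>1) - (\<integral>x. P t f x \<partial>\<nu>2)\<bar> < d') at_top"
      if "pr \<nu>1" "pr \<nu>2" "2 * B < d'" for \<nu>1 \<nu>2 d'
      using eventually_ge_at_top[of "0 :: real"]
    proof eventually_elim
      case (elim t)
      have m: "P t f \<in> borel_measurable borel" by (rule bcont_measurable[OF bcont_P[OF elim fb]])
      have "\<bar>\<integral>x. P t f x \<partial>\<nu>1\<bar> \<le> B" "\<bar>\<integral>x. P t f x \<partial>\<nu>2\<bar> \<le> B"
        using that by (auto intro!: abs_integral_le m P_bound elim fb B)
      then show ?case using that(3) by linarith
    qed
    then show ?thesis using B(1) by (auto simp: D_def merges_within_def)
  qed
  then have ne: "D \<noteq> {}" by auto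
  have bdd: "bdd_below D" by (auto simp: D_def)
  define m where "m = Inf D"
  have m0: "m \<ge> 0" unfolding m_def using ne by (intro cInf_greatest) (auto simp: D_def)
  have Qm: "merges_within f m"
    unfolding merges_within_def
  proof (intro allI impI)
    fix \<nu>1 \<nu>2 :: "'a measure" and d' assume a: "pr \<nu>1" "pr \<nu>2" "m < d'"
    obtain d where "d \<in> D" "d < d'" using cInf_lessD[OF ne a(3)[unfolded m_def]] by blast
    then show "eventually (\<lambda>t. \<bar>(\<integral>x. P t f x \<partial>\<nu>1) - (\<integral>x. P t f x \<partial>\<nu>2)\<bar> < d') at_top"
      using a by (auto simp: D_def merges_within_def)
  qed
  have "m \<le> 2 * \<eta>" if \<eta>: "\<eta> > 0" for \<eta>
  proof -
    obtain c where c: "0 < c" "c < 1"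
      "\<And>d. merges_within f d \<Longrightarrow> merges_within f (c * (2 * \<eta>) + (1 - c) * d)"
      using merges_within_contract[OF f \<eta>] by blast
    have "c * (2 * \<eta>) + (1 - c) * m \<in> D"
      using c(3)[OF Qm] c(1,2) m0 \<eta> by (auto simp: D_def)
    then have "m \<le> c * (2 * \<eta>) + (1 - c) * m"
      unfolding m_def by (rule cInf_lower[OF _ bdd])
    then have "c * m \<le> c * (2 * \<eta>)" by (simp add: algebra_simps)
    then show ?thesis using c(1) by simp
  qed
  \<comment> \<open>For \<open>m > 0\<close> the choice \<open>\<eta> = m / 4\<close> would give
    \<open>m \<le> m / 2\<close>.\<close>
  from this[of "m / 4"] m0 have "m = 0" by fastforce
  show ?thesis
  proof (rule tendstoI)
    fix e :: real assume "e > 0"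
    then show "eventually (\<lambda>t. dist ((\<integral>x. P t f x \<partial>\<nu>1) - (\<integral>x. P t f x \<partial>\<nu>2)) 0 < e) at_top"
      using Qm \<nu> unfolding merges_within_def \<open>m = 0\<close> by (simp add: dist_real_def)
  qed
qed

end

section \<open>Failure of tightness\<close>

text \<open>In a separable space this is the closure of the union of the topological supports; over
  a one-element index type it is the support of a single measure.\<close>

definition joint_support :: "('i \<Rightarrow> 'a::metric_space measure) \<Rightarrow> 'a set" where
  "joint_support M = {y. \<forall>r>0. \<exists>i. measure (M i) (ball y r) > 0}"

lemma closed_joint_support: "closed (joint_support M)"
  if prob: "\<And>i. prob_space (M i)" and sets: "\<And>i. sets (M i) = sets borel"
proof -
  have "open (- joint_support M)"
    unfolding open_contains_ball
  proof
    fix y assume "y \<in> - joint_support M"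
    then obtain r where r: "r > 0" "\<And>i. \<not> measure (M i) (ball y r) > 0"
      by (auto simp: joint_support_def)
    have "y' \<in> - joint_support M" if y': "y' \<in> ball y (r / 2)" for y'
    proof -
      have sub: "ball y' (r / 2) \<subseteq> ball y r"
      proof
        fix w assume "w \<in> ball y' (r / 2)"
        then show "w \<in> ball y r" using y' dist_triangle[of y w y'] by simp
      qed
      have "\<not> measure (M i) (ball y' (r / 2)) > 0" for i
      proof -
        interpret prob_space "M i" by (rule prob)
        show ?thesis using finite_measure_mono[OF sub, of] r(2)[of i] sets by simp
      qed
      then show ?thesis using r(1) by (auto simp: joint_support_def intro!: exI[of _ "r / 2"])
    qed
    then show "\<exists>e>0. ball y e \<subseteq> - joint_support M" using r(1) by (intro exI[of _ "r / 2"]) auto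
  qed
  then show ?thesis by (simp add: closed_def)
qed

text \<open>The complement is a union of balls that are null for all measures of the family;
  Lindelof's theorem makes the union countable.\<close>

lemma measure_joint_support:
  fixes M :: "'i \<Rightarrow> 'a::{metric_space, second_countable_topology} measure"
  assumes prob: "\<And>i. prob_space (M i)" and sets: "\<And>i. sets (M i) = sets borel"
  shows "measure (M i) (joint_support M) = 1"
proof -
  interpret prob_space "M i" by (rule prob)
  have space: "space (M i) = UNIV" using sets_eq_imp_space_eq[OF sets] by simp
  define \<F> where "\<F> = {ball y r | y r. r > 0 \<and> (\<forall>i. \<not> measure (M i) (ball y r) > 0)}"
  obtain \<F>' where \<F>': "\<F>' \<subseteq> \<F>" "countable \<F>'" "\<Union>\<F>' = \<Union>\<F>"
    by (rule Lindelof[of \<F>]) (auto simp: \<F>_def)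
  have "U \<in> null_sets (M i)" if "U \<in> \<F>'" for U
    using that \<F>'(1) sets[of i] measure_le_0_iff[of "M i" U]
    by (auto simp: \<F>_def null_sets_def emeasure_eq_measure not_less)
  then have null: "(\<Union>U\<in>\<F>'. U) \<in> null_sets (M i)"
    using \<F>'(2) by (intro null_sets_UN') auto
  have sub: "- joint_support M \<subseteq> \<Union>\<F>"
  proof
    fix y assume "y \<in> - joint_support M"
    then obtain r where "r > 0" "\<forall>i. \<not> measure (M i) (ball y r) > 0"
      by (auto simp: joint_support_def)
    then have "ball y r \<in> \<F>" "y \<in> ball y r" by (auto simp: \<F>_def)
    then show "y \<in> \<Union>\<F>" by blast
  qed
  have c: "joint_support M \<in> events"
    using closed_joint_support[of M, OF prob sets] sets by simp
  have "- joint_support M \<in> null_sets (M i)"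
  proof (rule null_sets_subset)
    show "\<Union>\<F> \<in> null_sets (M i)" using null \<F>'(3) by simp
    show "- joint_support M \<in> events"
      using sets.compl_sets[OF c] by (simp add: space Compl_eq_Diff_UNIV)
  qed (rule sub)
  then have "prob (- joint_support M) = 0" by (simp add: measure_eq_0_null_sets)
  then show ?thesis using prob_compl[OF c] by (simp add: space Compl_eq_Diff_UNIV)
qed

text \<open>Baire's theorem in the subspace \<open>F\<close>, completely metrizable because it is
  closed: some \<open>E n\<close> has nonempty interior relative to \<open>F\<close>.\<close>

lemma Baire_closed_nat:
  fixes F :: "'a::complete_space set"
  assumes F: "closed F" "F \<noteq> {}" and E: "\<And>n::nat. closed (E n)" "F = (\<Union>n. E n)"
  obtains n y r where "y \<in> F" "r > 0" "F \<inter> ball y r \<subseteq> E n"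
proof -
  have cm: "completely_metrizable_space (top_of_set F)"
    using F(1) by (intro completely_metrizable_space_closedin completely_metrizable_space_euclidean) auto
  have "\<exists>n. top_of_set F interior_of E n \<noteq> {}"
  proof (rule ccontr)
    assume "\<not> ?thesis"
    moreover have "closedin (top_of_set F) (E n)" for n
      using E by (auto intro!: closed_subset)
    ultimately have "top_of_set F interior_of (\<Union>(range E)) = {}"
      using cm by (intro Baire_category_alt) auto
    then show False using E(2) F(2) interior_of_topspace[of "top_of_set F"] by simp
  qed
  then obtain n y where y: "y \<in> top_of_set F interior_of E n" by auto
  then obtain V where V: "openin (top_of_set F) V" "y \<in> V" "V \<subseteq> E n"
    by (auto simp: interior_of_def)
  then obtain W where W: "open W" "V = F \<inter> W" by (auto simp: openin_open)
  then obtain r where "r > 0" "ball y r \<subseteq> W" using V(2) open_contains_ball by blast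
  then show ?thesis using V W by (intro that[of y r n]) auto
qed

lemma inner_compact:
  fixes M :: "'a::polish_space measure"
  assumes M: "prob_space M" "sets M = sets borel" and A: "A \<in> sets borel" and c: "c < measure M A"
  obtains C where "compact C" "C \<subseteq> A" "c < measure M C"
proof (cases "c < 0")
  \<comment> \<open>For negative \<open>c\<close> the value \<open>ennreal c\<close> is 0 and no
    longer reflects the real inequality; the empty set serves here.\<close>
  case True
  then show ?thesis by (intro that[of "{}"]) auto
next
  case False
  interpret prob_space M by (rule M)
  have "ennreal c < emeasure M A"
    using c False by (simp add: emeasure_eq_measure ennreal_less_iff)
  also have "emeasure M A = (SUP K\<in>{K. K \<subseteq> A \<and> compact K}. emeasure M K)"
    by (rule inner_regular[OF M(2) _ A]) (simp add: emeasure_space_1)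
  finally obtain C where "compact C" "C \<subseteq> A" "ennreal c < emeasure M C"
    by (auto simp: less_SUP_iff)
  then show ?thesis
    using False by (intro that[of C]) (auto simp: emeasure_eq_measure ennreal_less_iff)
qed

text \<open>Negating \<open>tight_seqI\<close> fixes an \<open>e\<close> such that, for every
  nonempty compact set, some \<open>\<mu> n\<close> puts more than \<open>e\<close> of its mass at
  distance at least \<open>e\<close> from it. Inner regularity makes the escaping part compact, so
  it can be added to what the next stage has to avoid.\<close>

lemma not_tight_separated_compacts:
  fixes \<mu> :: "nat \<Rightarrow> 'a::polish_space measure"
  assumes prob: "\<And>n. prob_space (\<mu> n)" and sets: "\<And>n. sets (\<mu> n) = sets borel"
    and nt: "\<not> tight_seq \<mu>"
  obtains e q D where "e > 0" "strict_mono q" "\<And>i::nat. compact (D i)" "\<And>i. D i \<noteq> {}"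
    "\<And>i. e < measure (\<mu> (q i)) (D i)"
    "\<And>i j x y. i \<noteq> j \<Longrightarrow> x \<in> D i \<Longrightarrow> y \<in> D j \<Longrightarrow> e \<le> dist x y"
proof -
  have space: "space (\<mu> n) = UNIV" for n using sets_eq_imp_space_eq[OF sets] by simp
  have "\<not> (\<forall>e>0. \<exists>C. compact C \<and> C \<noteq> {} \<and> (\<forall>n. 1 - e \<le> measure (\<mu> n) {x. infdist x C < e}))"
  proof
    assume near: "\<forall>e>0. \<exists>C. compact C \<and> C \<noteq> {} \<and> (\<forall>n. 1 - e \<le> measure (\<mu> n) {x. infdist x C < e})"
    have "tight_seq \<mu>" by (rule tight_seqI[OF prob sets]) (use near in blast)
    then show False using nt by simp
  qed
  then obtain e where e: "e > 0"
    and "\<forall>C. \<not> (compact C \<and> C \<noteq> {} \<and> (\<forall>n. 1 - e \<le> measure (\<mu> n) {x. infdist x C < e}))"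
    by blast
  then have far: "\<exists>n. measure (\<mu> n) {x. infdist x C < e} < 1 - e" if "compact C" "C \<noteq> {}" for C
    using that by (meson not_le)
  have near_m: "{x. infdist x C < e} \<in> sets borel" for C :: "'a set"
    by (intro borel_open open_Collect_less continuous_intros)
  have "\<exists>C. compact C \<and> 1 - e < measure (\<mu> n) C" for n
  proof -
    have "1 - e < measure (\<mu> n) UNIV"
      using e prob_space.prob_space[OF prob[of n]] by (simp add: space)
    then show ?thesis by (rule inner_compact[OF prob sets, rotated]) auto
  qed
  then have "\<exists>C0. \<forall>n. compact (C0 n) \<and> 1 - e < measure (\<mu> n) (C0 n)"
    by (intro choice allI)
  then obtain C0 where C0: "\<And>n. compact (C0 n)" "\<And>n. 1 - e < measure (\<mu> n) (C0 n)" by blast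
  have step: "\<exists>n B. N < n \<and> compact B \<and> B \<noteq> {} \<and> e < measure (\<mu> n) B \<and> (\<forall>x\<in>B. e \<le> infdist x C)"
    if C: "compact C" "C \<noteq> {}" for C and N :: nat
  proof -
    \<comment> \<open>Each \<open>C0 n\<close> holds more than \<open>1 - e\<close> of the mass of
      \<open>\<mu> n\<close>; including those with \<open>n \<le> N\<close> forces the new index
      beyond \<open>N\<close>.\<close>
    let ?C = "C \<union> (\<Union>n\<le>N. C0 n)"
    have "compact ?C" using C C0 by (intro compact_Un compact_UN) auto
    from far[OF this] C(2) obtain n where n: "measure (\<mu> n) {x. infdist x ?C < e} < 1 - e" by auto
    interpret prob_space "\<mu> n" by (rule prob)
    have "N < n"
    proof (rule ccontr)
      assume "\<not> N < n"
      then have "C0 n \<subseteq> ?C" by auto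
      then have "C0 n \<subseteq> {x. infdist x ?C < e}" using e infdist_zero[of _ ?C] by (metis (mono_tags, lifting) mem_Collect_eq subset_iff)
      then have "prob (C0 n) \<le> prob {x. infdist x ?C < e}"
        using near_m sets by (intro finite_measure_mono) auto
      then show False using n C0(2)[of n] by simp
    qed
    have Am: "{x. e \<le> infdist x ?C} \<in> sets borel"
      by (intro borel_closed closed_Collect_le continuous_intros)
    have "{x. e \<le> infdist x ?C} = space (\<mu> n) - {x. infdist x ?C < e}" by (auto simp: space)
    then have big: "e < prob {x. e \<le> infdist x ?C}"
      using prob_compl[of "{x. infdist x ?C < e}"] near_m[of ?C] sets n by simp
    obtain B where B: "compact B" "B \<subseteq> {x. e \<le> infdist x ?C}" "e < prob B"
      by (rule inner_compact[OF prob sets Am big]) auto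
    have "e \<le> infdist x C" if "x \<in> B" for x
      using B(2) that C(2) infdist_mono[of C ?C x] by force
    moreover have "B \<noteq> {}" using B(3) e by auto
    ultimately show ?thesis using B \<open>N < n\<close> by blast
  qed
  \<comment> \<open>A state holds a compact set \<open>C\<close> containing all sets chosen so far,
    the current index and the current set; the next set must stay away from
    \<open>C\<close>.\<close>
  define Good where "Good s \<longleftrightarrow> (case s of (C, n, B) \<Rightarrow> compact C \<and> compact B \<and> B \<noteq> {} \<and> B \<subseteq> C
      \<and> e < measure (\<mu> n) B)" for s :: "'a set \<times> nat \<times> 'a set"
  define Next where "Next s s' \<longleftrightarrow> (case s of (C, n, B) \<Rightarrow> case s' of (C', n', B') \<Rightarrow>
      C \<subseteq> C' \<and> n < n' \<and> (\<forall>x\<in>B'. e \<le> infdist x C))" for s s' :: "'a set \<times> nat \<times> 'a set"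
  have "\<exists>f. \<forall>m. Good (f m) \<and> Next (f m) (f (Suc m))"
  proof (rule dependent_nat_choice)
    obtain n B where "compact B" "B \<noteq> {}" "e < measure (\<mu> n) B"
      using step[of "{undefined}" 0] by auto
    then have "Good (B, n, B)" by (simp add: Good_def)
    then show "\<exists>s. Good s" by blast
  next
    fix s :: "'a set \<times> nat \<times> 'a set" assume g: "Good s"
    obtain C n B where s: "s = (C, n, B)" by (cases s)
    obtain n' B' where "n < n'" "compact B'" "B' \<noteq> {}" "e < measure (\<mu> n') B'" "\<forall>x\<in>B'. e \<le> infdist x C"
      using step[of C n] g s by (auto simp: Good_def)
    then have "Good (C \<union> B', n', B') \<and> Next s (C \<union> B', n', B')"
      using g s by (auto simp: Good_def Next_def intro: compact_Un)
    then show "\<exists>s'. Good s' \<and> Next s s'" by blast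
  qed
  then obtain f where f: "\<And>m. Good (f m)" "\<And>m. Next (f m) (f (Suc m))" by auto
  define C where "C m = fst (f m)" for m
  define q where "q m = fst (snd (f m))" for m
  define D where "D m = snd (snd (f m))" for m
  have good: "compact (D m)" "D m \<noteq> {}" "D m \<subseteq> C m" "e < measure (\<mu> (q m)) (D m)" for m
    using f(1)[of m] by (auto simp: Good_def C_def q_def D_def split: prod.splits)
  have nxt: "C m \<subseteq> C (Suc m)" "q m < q (Suc m)" "\<And>x. x \<in> D (Suc m) \<Longrightarrow> e \<le> infdist x (C m)" for m
    using f(2)[of m] by (auto simp: Next_def C_def q_def D_def split: prod.splits)
  have Cmono: "C i \<subseteq> C j" if "i \<le> j" for i j
    using nxt(1) that by (rule lift_Suc_mono_le)
  have sep: "e \<le> dist x y" if ij: "i < j" "x \<in> D i" "y \<in> D j" for i j x y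
  proof -
    obtain k where k: "j = Suc k" "i \<le> k" using ij(1) by (cases j) auto
    then have "x \<in> C k" using good(3) Cmono ij(2) by blast
    have "e \<le> infdist y (C k)" using nxt(3) ij(3) k by simp
    also have "\<dots> \<le> dist y x" using \<open>x \<in> C k\<close> by (rule infdist_le)
    finally show ?thesis by (simp add: dist_commute)
  qed
  have "e \<le> dist x y" if "i \<noteq> j" "x \<in> D i" "y \<in> D j" for i j x y
    using sep[of i j x y] sep[of j i y x] that by (auto simp: dist_commute neq_iff)
  moreover have "strict_mono q" using nxt(2) by (rule strict_monoI_Suc)
  ultimately show ?thesis using e good by (intro that[of e q D]) auto
qed

text \<open>The slope \<open>3 / e\<close> is the same for every \<open>A\<close>, so infinite
  unions keep the Lipschitz constant, and it is steep enough that tents over sets at mutual distance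
  \<open>e\<close> do not overlap.\<close>

definition bump :: "real \<Rightarrow> 'a::metric_space set \<Rightarrow> 'a \<Rightarrow> real" where
  "bump e A x = max 0 (1 - 3 / e * infdist x A)"

lemma bump_nonneg: "0 \<le> bump e A x"
  by (simp add: bump_def)

lemma bump_le_1: "e > 0 \<Longrightarrow> bump e A x \<le> 1"
  by (simp add: bump_def infdist_nonneg)

lemma bump_eq_1: "x \<in> A \<Longrightarrow> bump e A x = 1"
  by (simp add: bump_def infdist_zero)

lemma bump_eq_0: "e > 0 \<Longrightarrow> e / 3 \<le> infdist x A \<Longrightarrow> bump e A x = 0"
  by (simp add: bump_def field_simps)

lemma bounded_lipschitz_bump:
  assumes e: "e > 0"
  shows "bounded_lipschitz (bump e A)"
proof (rule bounded_lipschitzI[where L = "3 / e" and B = 1])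
  show "bump e A x \<le> bump e A y + 3 / e * dist x y" for x y
  proof -
    have "infdist y A \<le> infdist x A + dist y x" by (rule infdist_triangle)
    then have "3 / e * infdist y A \<le> 3 / e * (infdist x A + dist x y)"
      using e by (intro mult_left_mono) (auto simp: dist_commute)
    then have *: "1 - 3 / e * infdist x A \<le> 1 - 3 / e * infdist y A + 3 / e * dist x y"
      by (simp add: distrib_left)
    have "0 \<le> 3 / e * dist x y" using e by simp
    then show ?thesis using * unfolding bump_def by linarith
  qed
  show "\<bar>bump e A x\<bar> \<le> 1" for x
    using bump_nonneg[of e A x] bump_le_1[OF e, of A x] by simp
qed (use e in simp)

section \<open>Sums of bumps over a separated family\<close>

locale separated_family =
  fixes e :: real and D :: "nat \<Rightarrow> 'a::metric_space set"
  assumes e: "e > 0" and ne: "\<And>i. D i \<noteq> {}"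
    and sep: "\<And>i j x y. i \<noteq> j \<Longrightarrow> x \<in> D i \<Longrightarrow> y \<in> D j \<Longrightarrow> e \<le> dist x y"
begin

lemma far_from_others:
  assumes "infdist x (D i) < e / 3" "j \<noteq> i"
  shows "e / 3 \<le> infdist x (D j)"
proof (rule ccontr)
  assume "\<not> ?thesis"
  then obtain y y' where y: "y \<in> D i" "dist x y < e / 3" and y': "y' \<in> D j" "dist x y' < e / 3"
    using assms infdist_less_iff[OF ne] by (metis not_le)
  have "e \<le> dist y' y" using sep[OF assms(2) y'(1) y(1)] .
  also have "\<dots> \<le> dist y' x + dist x y" by (rule dist_triangle)
  finally show False using y y' e by (simp add: dist_commute)
qed

text \<open>At each point at most one bump is nonzero, so an infinite sum of them is again a single
  Lipschitz test function. For \<open>I = {}\<close> this fails: \<open>infdist x {} = 0\<close>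
  makes the bump of the empty set constantly 1.\<close>

lemma bump_UN:
  assumes I: "I \<noteq> {}"
  shows "(\<lambda>j. indicator I j * bump e (D j) x) sums bump e (\<Union>i\<in>I. D i) x"
proof (cases "\<exists>i\<in>I. infdist x (D i) < e / 3")
  case True
  then obtain i where i: "i \<in> I" "infdist x (D i) < e / 3" by auto
  have zero: "bump e (D j) x = 0" if "j \<noteq> i" for j
    using far_from_others[OF i(2) that] e by (intro bump_eq_0)
  have "infdist x (\<Union>i\<in>I. D i) = infdist x (D i)"
  proof (rule antisym)
    show "infdist x (\<Union>i\<in>I. D i) \<le> infdist x (D i)"
      using i ne by (intro infdist_mono) auto
    have "infdist x (D i) \<le> dist x y" if "y \<in> D j" for j y
    proof (cases "j = i")
      case False
      have "infdist x (D i) < e / 3" by (rule i)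
      also have "\<dots> \<le> infdist x (D j)" by (rule far_from_others[OF i(2) False])
      also have "\<dots> \<le> dist x y" using that by (rule infdist_le)
      finally show ?thesis by simp
    qed (use that infdist_le in blast)
    moreover have "(\<Union>i\<in>I. D i) \<noteq> {}" using i ne by auto
    ultimately show "infdist x (D i) \<le> infdist x (\<Union>i\<in>I. D i)"
      by (subst (2) infdist_notempty) (auto intro!: cINF_greatest)
  qed
  then have "bump e (\<Union>i\<in>I. D i) x = indicator I i * bump e (D i) x"
    using i by (simp add: bump_def)
  moreover have "(\<lambda>j. indicator I j * bump e (D j) x) = (\<lambda>j. if j = i then indicator I j * bump e (D j) x else 0)"
    using zero by auto
  moreover have "\<dots> sums (indicator I i * bump e (D i) x)"
    by (rule sums_single)
  ultimately show ?thesis by metis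
next
  case False
  then have "indicator I j * bump e (D j) x = 0" for j
    using e by (cases "j \<in> I") (auto intro!: bump_eq_0 simp: not_less)
  moreover have "e / 3 \<le> infdist x (\<Union>i\<in>I. D i)"
  proof (rule ccontr)
    assume "\<not> ?thesis"
    then have "infdist x (\<Union>i\<in>I. D i) < e / 3" by simp
    moreover have "(\<Union>i\<in>I. D i) \<noteq> {}" using I ne by auto
    ultimately obtain i y where "i \<in> I" "y \<in> D i" "dist x y < e / 3"
      using infdist_less_iff[of "\<Union>i\<in>I. D i"] by blast
    then show False using False infdist_less_iff[OF ne] by blast
  qed
  then have "bump e (\<Union>i\<in>I. D i) x = 0" by (rule bump_eq_0[OF e])
  ultimately show ?thesis using sums_zero by (simp only:)
qed

lemma sum_bump_le_1: "finite J \<Longrightarrow> (\<Sum>j\<in>J. bump e (D j) x) \<le> 1"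
proof -
  assume J: "finite J"
  show ?thesis
  proof (cases "J = {}")
    case False
    have "(\<Sum>j\<in>J. bump e (D j) x) = (\<Sum>j\<in>J. indicator J j * bump e (D j) x)"
      by (intro sum.cong) auto
    also have "(\<lambda>j. indicator J j * bump e (D j) x) sums \<dots>"
      by (rule sums_finite[OF J]) auto
    then have "\<dots> = bump e (\<Union>i\<in>J. D i) x"
      using bump_UN[OF False] sums_unique2 by blast
    also have "\<dots> \<le> 1" by (rule bump_le_1[OF e])
    finally show ?thesis .
  qed simp
qed

lemma bcont_bump: "bcont (bump e A)"
  by (intro bounded_lipschitz_bcont bounded_lipschitz_bump e)

context
  fixes M :: "'a measure"
  assumes M: "prob_space M" "sets M = sets borel"
begin

lemma summable_integral_bump: "summable (\<lambda>j. \<integral>x. bump e (D j) x \<partial>M)"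
proof (rule summableI_nonneg_bounded)
  interpret prob_space M by (rule M)
  fix n
  show "0 \<le> (\<integral>x. bump e (D n) x \<partial>M)" by (intro integral_nonneg_AE) (simp add: bump_nonneg)
  have "(\<Sum>j<n. \<integral>x. bump e (D j) x \<partial>M) = (\<integral>x. (\<Sum>j<n. bump e (D j) x) \<partial>M)"
    by (subst Bochner_Integration.integral_sum) (auto intro: bcont_integrable[OF bcont_bump M])
  also have "\<dots> \<le> 1"
    by (intro integral_le_const Bochner_Integration.integrable_sum bcont_integrable[OF bcont_bump M] AE_I2
        sum_bump_le_1) simp
  finally show "(\<Sum>j<n. \<integral>x. bump e (D j) x \<partial>M) \<le> 1" .
qed

lemma summable_indicator_integral_bump:
  "summable (\<lambda>j. indicator I j * (\<integral>x. bump e (D j) x \<partial>M))"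
proof (rule summable_comparison_test[OF _ summable_integral_bump], intro exI allI impI)
  fix j
  have "0 \<le> (\<integral>x. bump e (D j) x \<partial>M)" by (intro integral_nonneg_AE) (simp add: bump_nonneg)
  then show "norm (indicator I j * (\<integral>x. bump e (D j) x \<partial>M)) \<le> (\<integral>x. bump e (D j) x \<partial>M)"
    by (simp add: indicator_def)
qed

text \<open>Turns the integral of one Lipschitz function into a subsum over \<open>I\<close>, the
  form in which \<open>phillips_diagonal\<close> can exploit merging.\<close>

lemma integral_bump_UN:
  assumes I: "I \<noteq> {}"
  shows "(\<integral>x. bump e (\<Union>i\<in>I. D i) x \<partial>M) = (\<Sum>j. indicator I j * (\<integral>x. bump e (D j) x \<partial>M))"
proof -
  let ?f = "\<lambda>j x. indicator I j * bump e (D j) x"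
  have nn: "norm (?f j x) = ?f j x" for j x by (simp add: bump_nonneg indicator_def)
  have "(\<integral>x. (\<Sum>j. ?f j x) \<partial>M) = (\<Sum>j. \<integral>x. ?f j x \<partial>M)"
  proof (rule integral_suminf)
    show "integrable M (?f j)" for j
      by (intro integrable_mult_right bcont_integrable[OF bcont_bump M])
    show "AE x in M. summable (\<lambda>j. norm (?f j x))"
      unfolding nn using sums_summable[OF bump_UN[OF I]] by simp
    show "summable (\<lambda>j. \<integral>x. norm (?f j x) \<partial>M)"
      unfolding nn using summable_indicator_integral_bump by simp
  qed
  then show ?thesis using sums_unique[OF bump_UN[OF I]] by simp
qed

end

end

section \<open>Tightness of the orbit and asymptotic stability\<close>

context eventually_continuous_semigroup
begin

lemma integral_return_bcont: "bcont f \<Longrightarrow> (\<integral>x. f x \<partial>return borel y) = f y"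
  by (rule integral_return) (auto intro: bcont_measurable)

lemma P_merges:
  assumes f: "bounded_lipschitz f"
  shows "((\<lambda>t. P t f x - P t f y) \<longlongrightarrow> 0) at_top"
proof (rule Lim_transform_eventually[OF merges[OF f pr_return[of x] pr_return[of y]]])
  show "eventually (\<lambda>t. (\<integral>w. P t f w \<partial>return borel x) - (\<integral>w. P t f w \<partial>return borel y) = P t f x - P t f y) at_top"
    using eventually_ge_at_top[of 0]
    by eventually_elim (simp add: integral_return_bcont bcont_P bounded_lipschitz_bcont[OF f])
qed

lemma P_add:
  assumes "s \<ge> 0" "t \<ge> 0" "bcont f"
  shows "P (s + t) f x = (\<integral>y. P t f y \<partial>K s x)"
  using integral_bind_P[OF assms(2) pr_kernel[OF assms(1)] assms(3)] assms
  by (simp add: P_def[of "s + t"] kernel_add)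

abbreviation reach :: "'a set" where
  "reach \<equiv> joint_support (\<lambda>n::nat. K (real n) z)"

lemma prob_kernel: "t \<ge> 0 \<Longrightarrow> prob_space (K t x)" "t \<ge> 0 \<Longrightarrow> sets (K t x) = sets borel"
  using prob_algebraD(1,2)[OF pr_kernel] by auto

text \<open>By the Feller property, points near \<open>z\<close> enter the ball around
  \<open>y\<close> at time \<open>n\<close> with probability at least \<open>c0\<close>; the lower
  bound places the orbit of \<open>z\<close> near \<open>z\<close> with probability at least
  \<open>a\<close> at every late time. The Markov property multiplies the two.\<close>

lemma recurrent_ball:
  assumes y: "y \<in> reach" and r: "r > 0"
  obtains c T where "c > 0" "\<And>t. t \<ge> T \<Longrightarrow> c \<le> measure (K t z) (ball y r)"
proof -
  obtain n where n: "measure (K (real n) z) (ball y r) > 0"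
    using y r by (auto simp: joint_support_def)
  obtain m where m: "(\<integral>x. open_bump (ball y r) m x \<partial>K (real n) z) > 0"
    by (rule open_bump_integral_pos[OF prob_kernel open_ball n]) auto
  \<comment> \<open>The Feller property applies to a continuous minorant of the indicator of the
    ball, not to the indicator itself. Half of its value leaves an open neighbourhood of
    \<open>z\<close>.\<close>
  define \<phi> where "\<phi> = open_bump (ball y r) m"
  define c0 where "c0 = P n \<phi> z / 2"
  have c0: "c0 > 0" "c0 < P n \<phi> z" using m by (auto simp: c0_def \<phi>_def P_def)
  have \<phi>: "bcont \<phi>" unfolding \<phi>_def by (rule bcont_open_bump)
  have "open {x. c0 < P n \<phi> x}"
    by (intro open_Collect_less continuous_on_const bcont_continuous bcont_P \<phi>) simp
  then obtain d where d: "d > 0" "ball z d \<subseteq> {x. c0 < P n \<phi> x}"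
    using c0(2) unfolding open_contains_ball by auto
  obtain a where a: "a > 0" "\<And>x. eventually (\<lambda>t. a < measure (K t x) (ball z d)) at_top"
    by (rule lower_bound_ball[OF d(1)]) blast
  then obtain T0 where T0: "\<And>t. t \<ge> T0 \<Longrightarrow> a < measure (K t z) (ball z d)"
    by (meson eventually_at_top_linorder)
  have "c0 * a \<le> measure (K t z) (ball y r)" if t: "t \<ge> max T0 0 + n" for t
  proof -
    define s where "s = t - n"
    have s: "s \<ge> T0" "s \<ge> 0" "t = s + n" using t by (auto simp: s_def)
    have "c0 * indicator (ball z d) x \<le> measure (K n x) (ball y r)" for x
    proof (cases "x \<in> ball z d")
      case True
      then have "c0 \<le> P n \<phi> x" using d(2) by auto
      also have "\<dots> \<le> measure (K n x) (ball y r)"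
        unfolding P_def \<phi>_def by (intro open_bump_integral_le prob_kernel) auto
      finally show ?thesis using True by simp
    qed simp
    note le = this
    interpret prob_space "K s z" by (rule prob_kernel[OF s(2)])
    have m: "(\<lambda>x. measure (K n x) (ball y r)) \<in> borel_measurable (K s z)"
      using measurable_measure_kernel[of n "ball y r"] prob_kernel(2)[OF s(2)]
      by (simp cong: measurable_cong_sets)
    have "c0 * a \<le> c0 * prob (ball z d)"
      using T0[OF s(1)] c0 by simp
    also have "\<dots> = (\<integral>x. c0 * indicator (ball z d) x \<partial>K s z)"
      using prob_kernel(2)[OF s(2)] by simp
    also have "\<dots> \<le> (\<integral>x. measure (K n x) (ball y r) \<partial>K s z)"
    proof (rule integral_mono[OF _ _ le])
      show "integrable (K s z) (\<lambda>x. c0 * indicator (ball z d) x)"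
        using prob_kernel(2)[OF s(2)]
        by (intro integrable_mult_right integrable_real_indicator) (auto simp: emeasure_eq_measure)
      show "integrable (K s z) (\<lambda>x. measure (K n x) (ball y r))"
        using m prob_space.prob_le_1[OF prob_kernel(1)[of n]]
        by (intro integrable_const_bound[where B = 1]) auto
    qed
    also have "\<dots> = measure (K t z) (ball y r)"
      using measure_bind_kernel[OF _ pr_kernel[OF s(2)], of n "ball y r" z] s
      by (simp add: kernel_add)
    finally show ?thesis .
  qed
  then show ?thesis using a(1) c0(1) by (intro that[of "c0 * a" "max T0 0 + n"]) auto
qed

text \<open>If the orbit of \<open>z\<close> were not tight, it would put mass \<open>e\<close> at times \<open>q i\<close> on uniformly
  separated compact sets \<open>D i\<close>. By the gliding hump argument and Baire's theorem the same then holds,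
  with mass \<open>e/2\<close>, for all starting points in one set that is recurrent from \<open>z\<close>. At a
  sufficiently late time the orbit of \<open>z\<close> has passed through that set at each of the times needed to
  charge many of the disjoint neighbourhoods of the \<open>D i\<close> simultaneously, exceeding total mass one.\<close>

lemma tight_orbit: "tight_seq (\<lambda>n. K (real n) z)"
proof (rule ccontr)
  assume nt: "\<not> ?thesis"
  obtain e q D where e: "e > 0" and q: "strict_mono q" and D: "\<And>i::nat. compact (D i)" "\<And>i. D i \<noteq> {}"
    and mass: "\<And>i. e < measure (K (real (q i)) z) (D i)"
    and sep: "\<And>i j x y. i \<noteq> j \<Longrightarrow> x \<in> D i \<Longrightarrow> y \<in> D j \<Longrightarrow> e \<le> dist x y"
    by (rule not_tight_separated_compacts[OF prob_kernel nt]) auto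
  interpret separated_family e D
    by unfold_locales (use e D sep in auto)
  let ?b = "\<lambda>i. bump e (D i)"
  have qtop: "filterlim (\<lambda>i. real (q i)) at_top sequentially"
    by (rule filterlim_compose[OF filterlim_real_sequentially filterlim_subseq[OF q]])
  \<comment> \<open>Merging concerns a fixed function, while here the function varies with
    \<open>i\<close>. The bump of the union over any index set \<open>I\<close> is fixed, and its
    merging for all \<open>I\<close> is the hypothesis of the gliding hump lemma.\<close>
  have diag: "(\<lambda>i. P (q i) (?b i) x - P (q i) (?b i) z) \<longlonglongrightarrow> 0" for x
  proof (rule phillips_diagonal[where a = "\<lambda>i j. P (q i) (?b j) x - P (q i) (?b j) z"])
    have summ: "summable (\<lambda>j. P (q i) (?b j) w)" for i w
      unfolding P_def by (intro summable_integral_bump prob_kernel) auto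
    have nn: "P (q i) (?b j) w \<ge> 0" for i j w
      unfolding P_def by (intro integral_nonneg_AE) (simp add: bump_nonneg)
    show "summable (\<lambda>j. \<bar>P (q i) (?b j) x - P (q i) (?b j) z\<bar>)" for i
    proof (rule summable_comparison_test[OF _ summable_add[OF summ[of i x] summ[of i z]]])
      have "\<bar>P (q i) (?b j) x - P (q i) (?b j) z\<bar> \<le> P (q i) (?b j) x + P (q i) (?b j) z" for j
        using nn[of i j x] nn[of i j z] by linarith
      then show "\<exists>N. \<forall>j\<ge>N. norm \<bar>P (q i) (?b j) x - P (q i) (?b j) z\<bar> \<le> P (q i) (?b j) x + P (q i) (?b j) z"
        by simp
    qed
    show "(\<lambda>i. \<Sum>j. indicator I j * (P (q i) (?b j) x - P (q i) (?b j) z)) \<longlonglongrightarrow> 0" for I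
    proof (cases "I = {}")
      case False
      have "(\<Sum>j. indicator I j * (P (q i) (?b j) x - P (q i) (?b j) z))
          = P (q i) (bump e (\<Union>i\<in>I. D i)) x - P (q i) (bump e (\<Union>i\<in>I. D i)) z" for i
      proof -
        have "P (q i) (bump e (\<Union>i\<in>I. D i)) w = (\<Sum>j. indicator I j * P (q i) (?b j) w)"
          "summable (\<lambda>j. indicator I j * P (q i) (?b j) w)" for w
          unfolding P_def
          by (rule integral_bump_UN summable_indicator_integral_bump; simp add: prob_kernel False)+
        then show ?thesis by (simp add: suminf_diff right_diff_distrib)
      qed
      then show ?thesis
        using filterlim_compose[OF P_merges[OF bounded_lipschitz_bump[OF e], of "\<Union>i\<in>I. D i" x z] qtop] by simp
    qed simp
  qed
  \<comment> \<open>The Feller property makes these sets closed, and \<open>diag\<close> makes them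
    cover \<open>reach\<close>, as Baire's theorem requires.\<close>
  define E where "E T = (\<Inter>i\<in>{T..}. {x. \<bar>P (q i) (?b i) x - P (q i) (?b i) z\<bar> \<le> e / 2}) \<inter> reach" for T
  have closed_reach: "closed reach" by (intro closed_joint_support prob_kernel) auto
  have closedE: "closed (E T)" for T
    unfolding E_def
    by (intro closed_Int closed_INT ballI closed_Collect_le continuous_on_const continuous_on_rabs
        continuous_on_diff bcont_continuous[OF bcont_P[OF _ bcont_bump]] closed_reach) simp
  have z: "z \<in> reach"
  proof -
    have "K 0 z = return borel z" using markov_feller by (simp add: markov_feller_semigroup_def)
    then have "measure (K (real 0) z) (ball z r) > 0" if "r > 0" for r
      using that by (simp add: measure_return)
    then show ?thesis unfolding joint_support_def by blast
  qed
  have "x \<in> (\<Union>T. E T)" if "x \<in> reach" for x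
  proof -
    have "eventually (\<lambda>i. \<bar>P (q i) (?b i) x - P (q i) (?b i) z\<bar> < e / 2) sequentially"
      using tendsto_rabs[OF diag[of x]] e by (intro order_tendstoD) auto
    then show ?thesis using that by (auto simp: E_def eventually_sequentially intro: less_imp_le)
  qed
  then have "reach = (\<Union>T. E T)" by (auto simp: E_def)
  then obtain T y r where y: "y \<in> reach" "r > 0" "reach \<inter> ball y r \<subseteq> E T"
    by (rule Baire_closed_nat[OF closed_reach _ closedE, rotated]) (use z in auto)
  obtain c T0 where c: "c > 0" "\<And>t. t \<ge> T0 \<Longrightarrow> c \<le> measure (K t z) (ball y r)"
    by (rule recurrent_ball[OF y(1,2)]) blast
  \<comment> \<open>Mass at least \<open>c * (e / 2)\<close> near each of \<open>N\<close> sets with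
    disjoint bumps would exceed the total mass 1.\<close>
  obtain N :: nat where N: "1 < real N * (c * (e / 2))"
    using reals_Archimedean3[of "c * (e / 2)"] mult_pos_pos[of c "e / 2"] c(1) e by fastforce
  \<comment> \<open>Late enough that the recurrence bound already holds at each of the times
    \<open>m - q i\<close> with \<open>i < T + N\<close>.\<close>
  define m where "m = nat \<lceil>T0\<rceil> + q (T + N)"
  have lower: "c * (e / 2) \<le> P m (?b i) z" if i: "T \<le> i" "i < T + N" for i
  proof -
    define s where "s = m - q i"
    have "q i \<le> q (T + N)" using i q by (simp add: strict_mono_less_eq)
    then have s: "m = s + q i" "real s \<ge> T0" by (auto simp: s_def m_def) linarith
    interpret prob_space "K s z" by (rule prob_kernel) simp
    have sets: "sets (K s z) = sets borel" by (rule prob_kernel) simp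
    have nn: "P (q i) (?b i) w \<ge> 0" for w
      unfolding P_def by (intro integral_nonneg_AE) (simp add: bump_nonneg)
    have start: "e \<le> P (q i) (?b i) z"
    proof -
      interpret Q: prob_space "K (q i) z" by (rule prob_kernel) simp
      have Dm: "D i \<in> sets (K (q i) z)"
        using prob_kernel(2)[of "q i" z] D(1)[of i] by (simp add: compact_imp_closed)
      have "measure (K (q i) z) (D i) = (\<integral>x. indicator (D i) x \<partial>K (q i) z)"
        using Dm by simp
      also have "\<dots> \<le> P (q i) (?b i) z"
        unfolding P_def using Dm
        by (intro integral_mono integrable_real_indicator bcont_integrable[OF bcont_bump prob_kernel])
          (auto simp: Q.emeasure_eq_measure bump_nonneg bump_eq_1 indicator_def)
      finally show ?thesis using mass[of i] by simp
    qed
    have mR: "reach \<inter> ball y r \<in> events" using sets closed_reach by auto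
    have "c \<le> prob (ball y r)" by (rule c(2)[OF s(2)])
    \<comment> \<open>The orbit at integer times is carried by \<open>reach\<close>, so the mass of
      the ball sits in the part contained in \<open>E T\<close>.\<close>
    also have "\<dots> = prob (reach \<inter> ball y r)"
    proof -
      have "AE x in K s z. x \<in> reach"
        using measure_joint_support[of "\<lambda>n::nat. K (real n) z" s] prob_kernel closed_reach sets
        by (intro AE_prob_1) auto
      then show ?thesis using mR sets by (intro finite_measure_eq_AE) auto
    qed
    finally have "c * (e / 2) \<le> prob (reach \<inter> ball y r) * (e / 2)" using e by simp
    also have "\<dots> = (\<integral>x. (e / 2) * indicator (reach \<inter> ball y r) x \<partial>K s z)"
      using mR by simp
    also have "\<dots> \<le> (\<integral>x. P (q i) (?b i) x \<partial>K s z)"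
    proof (intro integral_mono integrable_mult_right integrable_real_indicator mR
        bcont_integrable[OF bcont_P[OF _ bcont_bump] prob_kernel])
      fix x
      show "e / 2 * indicator (reach \<inter> ball y r) x \<le> P (q i) (?b i) x"
      proof (cases "x \<in> reach \<inter> ball y r")
        case True
        then have "\<bar>P (q i) (?b i) x - P (q i) (?b i) z\<bar> \<le> e / 2"
          using y(3) i(1) by (auto simp: E_def)
        then have "e / 2 \<le> P (q i) (?b i) x" using start by linarith
        then show ?thesis using True by simp
      qed (use nn[of x] in simp)
    qed (auto simp: emeasure_eq_measure)
    also have "\<dots> = P m (?b i) z"
      unfolding s(1) of_nat_add by (rule P_add[symmetric]) (auto intro: bcont_bump)
    finally show ?thesis .
  qed
  interpret prob_space "K m z" by (rule prob_kernel) simp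
  have "real N * (c * (e / 2)) = (\<Sum>i\<in>{T..<T + N}. c * (e / 2))" by simp
  also have "\<dots> \<le> (\<Sum>i\<in>{T..<T + N}. P m (?b i) z)" by (intro sum_mono lower) auto
  also have "\<dots> = (\<integral>x. (\<Sum>i\<in>{T..<T + N}. ?b i x) \<partial>K m z)"
    unfolding P_def
    by (subst Bochner_Integration.integral_sum) (auto intro!: bcont_integrable[OF bcont_bump prob_kernel])
  also have "\<dots> \<le> 1"
    by (intro integral_le_const Bochner_Integration.integrable_sum bcont_integrable[OF bcont_bump prob_kernel]
        AE_I2 sum_bump_le_1) auto
  finally show False using N by simp
qed

text \<open>By the semigroup property, testing the orbit of \<open>z\<close> with
  \<open>P s f\<close> instead of \<open>f\<close> amounts to starting from \<open>K s z\<close>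
  instead of \<open>z\<close>. Merging makes the difference vanish, and the Feller property allows
  \<open>P s f\<close> as a test function for the cluster point.\<close>

lemma invariant_exists: "\<exists>\<pi>. invariant_measure K \<pi>"
proof -
  let ?\<mu> = "\<lambda>n::nat. K (real n) z"
  obtain G \<pi> where G: "G \<noteq> bot" "G \<le> sequentially" and \<pi>: "prob_space \<pi>" "sets \<pi> = sets borel"
    and lim: "\<And>f. bcont f \<Longrightarrow> ((\<lambda>n. \<integral>x. f x \<partial>?\<mu> n) \<longlongrightarrow> (\<integral>x. f x \<partial>\<pi>)) G"
    by (rule tight_seq_cluster[OF prob_kernel tight_orbit]) auto
  have pr\<pi>: "pr \<pi>" using \<pi> by (simp add: space_prob_algebra)
  have "\<pi> \<bind> K s = \<pi>" if s: "s \<ge> 0" for s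
  proof (rule prob_measure_eqI_lipschitz)
    fix f :: "'a \<Rightarrow> real" assume f: "bounded_lipschitz f"
    note fb = bounded_lipschitz_bcont[OF f]
    have "(\<integral>x. P s f x \<partial>?\<mu> n) = (\<integral>x. P n f x \<partial>K s z)" for n
      using P_add[OF _ s fb, of n z] P_add[OF s _ fb, of n z] by (simp add: add.commute)
    moreover have "(\<integral>x. f x \<partial>?\<mu> n) = (\<integral>x. P n f x \<partial>return borel z)" for n
      by (simp add: integral_return_bcont bcont_P fb) (simp add: P_def)
    moreover have "((\<lambda>n. (\<integral>x. P (real n) f x \<partial>K s z) - (\<integral>x. P (real n) f x \<partial>return borel z)) \<longlongrightarrow> 0) sequentially"
      by (rule filterlim_compose[OF merges[OF f pr_kernel[OF s] pr_return] filterlim_real_sequentially])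
    ultimately have "((\<lambda>n. (\<integral>x. P s f x \<partial>?\<mu> n) - (\<integral>x. f x \<partial>?\<mu> n)) \<longlongrightarrow> 0) G"
      using filterlim_mono[OF _ order_refl G(2)] by simp
    moreover have "((\<lambda>n. (\<integral>x. P s f x \<partial>?\<mu> n) - (\<integral>x. f x \<partial>?\<mu> n)) \<longlongrightarrow> (\<integral>x. P s f x \<partial>\<pi>) - (\<integral>x. f x \<partial>\<pi>)) G"
      by (intro tendsto_diff lim fb bcont_P s)
    ultimately have "(\<integral>x. P s f x \<partial>\<pi>) - (\<integral>x. f x \<partial>\<pi>) = 0"
      using tendsto_unique[OF G(1)] by blast
    then show "(\<integral>x. f x \<partial>(\<pi> \<bind> K s)) = (\<integral>x. f x \<partial>\<pi>)"
      by (simp add: integral_bind_P[OF s pr\<pi> fb])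
  qed (use \<pi> prob_algebraD[OF pr_bind[OF s pr\<pi>]] in auto)
  with pr\<pi> show ?thesis by (auto simp: invariant_measure_def)
qed

text \<open>Every orbit merges with that of \<open>\<pi>\<close>, which is constant. The orbit of
  another invariant law is constant too, so its limit \<open>\<pi>\<close> equals that law.\<close>

lemma asymptotically_stable: "asymptotically_stable K"
proof -
  obtain \<pi> where inv: "invariant_measure K \<pi>" using invariant_exists by blast
  then have pr\<pi>: "pr \<pi>" and \<pi>: "\<And>t. t \<ge> 0 \<Longrightarrow> \<pi> \<bind> K t = \<pi>" by (auto simp: invariant_measure_def)
  have lip: "((\<lambda>t. \<integral>x. f x \<partial>(\<nu> \<bind> K t)) \<longlongrightarrow> (\<integral>x. f x \<partial>\<pi>)) at_top"
    if f: "bounded_lipschitz f" and \<nu>: "pr \<nu>" for f \<nu>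
  proof -
    note fb = bounded_lipschitz_bcont[OF f]
    have "((\<lambda>t. ((\<integral>x. P t f x \<partial>\<nu>) - (\<integral>x. P t f x \<partial>\<pi>)) + (\<integral>x. f x \<partial>\<pi>)) \<longlongrightarrow> 0 + (\<integral>x. f x \<partial>\<pi>)) at_top"
      by (intro tendsto_add merges f \<nu> pr\<pi> tendsto_const)
    then have lim: "((\<lambda>t. ((\<integral>x. P t f x \<partial>\<nu>) - (\<integral>x. P t f x \<partial>\<pi>)) + (\<integral>x. f x \<partial>\<pi>)) \<longlongrightarrow> (\<integral>x. f x \<partial>\<pi>)) at_top"
      by simp
    show ?thesis
    proof (rule Lim_transform_eventually[OF lim])
      show "eventually (\<lambda>t. ((\<integral>x. P t f x \<partial>\<nu>) - (\<integral>x. P t f x \<partial>\<pi>)) + (\<integral>x. f x \<partial>\<pi>)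
          = (\<integral>x. f x \<partial>(\<nu> \<bind> K t))) at_top"
        using eventually_ge_at_top[of 0]
      proof eventually_elim
        case (elim t)
        then show ?case
          using integral_bind_P[OF elim \<nu> fb] integral_bind_P[OF elim pr\<pi> fb] \<pi>[OF elim] by simp
      qed
    qed
  qed
  have "weak_conv_at_top (\<lambda>t. \<nu> \<bind> K t) \<pi>" if \<nu>: "pr \<nu>" for \<nu>
    unfolding weak_conv_at_top_def
  proof (intro allI impI)
    fix f :: "'a \<Rightarrow> real" assume "continuous_on UNIV f \<and> bounded (range f)"
    then have f: "bcont f" by (simp add: bcont_def)
    show "((\<lambda>t. \<integral>x. f x \<partial>(\<nu> \<bind> K t)) \<longlongrightarrow> (\<integral>x. f x \<partial>\<pi>)) at_top"
    proof (rule tendsto_integral_bcont_if_lipschitz[OF _ _ _ lip[OF _ \<nu>] f])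
      show "eventually (\<lambda>t. prob_space (\<nu> \<bind> K t) \<and> sets (\<nu> \<bind> K t) = sets borel) at_top"
        using eventually_ge_at_top[of 0]
        by eventually_elim (use prob_algebraD[OF pr_bind[OF _ \<nu>]] in auto)
    qed (use prob_algebraD[OF pr\<pi>] in auto)
  qed
  moreover have "\<nu> = \<pi>" if "invariant_measure K \<nu>" for \<nu>
  proof -
    have \<nu>: "pr \<nu>" and inv\<nu>: "\<And>t. t \<ge> 0 \<Longrightarrow> \<nu> \<bind> K t = \<nu>"
      using that by (auto simp: invariant_measure_def)
    show ?thesis
    proof (rule prob_measure_eqI_lipschitz)
      fix f :: "'a \<Rightarrow> real" assume f: "bounded_lipschitz f"
      have "((\<lambda>t::real. \<integral>x. f x \<partial>\<nu>) \<longlongrightarrow> (\<integral>x. f x \<partial>\<pi>)) at_top"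
      proof (rule Lim_transform_eventually[OF lip[OF f \<nu>]])
        show "eventually (\<lambda>t. (\<integral>x. f x \<partial>(\<nu> \<bind> K t)) = (\<integral>x. f x \<partial>\<nu>)) at_top"
          using eventually_ge_at_top[of 0] by eventually_elim (simp add: inv\<nu>)
      qed
      then show "(\<integral>x. f x \<partial>\<nu>) = (\<integral>x. f x \<partial>\<pi>)"
        using tendsto_unique[OF trivial_limit_at_top_linorder _ tendsto_const] by metis
    qed (use prob_algebraD[OF \<nu>] prob_algebraD[OF pr\<pi>] in auto)
  qed
  ultimately show ?thesis
    unfolding asymptotically_stable_def using inv by blast
qed

end

section \<open>Consequences of asymptotic stability\<close>

context markov_feller
begin

lemma stable_P_tendsto:
  assumes "asymptotically_stable K"
  obtains \<pi> where "pr \<pi>" "\<And>f x. bcont f \<Longrightarrow> ((\<lambda>t. P t f x) \<longlongrightarrow> (\<integral>y. f y \<partial>\<pi>)) at_top"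
proof -
  obtain \<pi> where \<pi>: "invariant_measure K \<pi>"
    and conv: "\<And>\<nu>. pr \<nu> \<Longrightarrow> weak_conv_at_top (\<lambda>t. \<nu> \<bind> K t) \<pi>"
    using assms unfolding asymptotically_stable_def by blast
  have "((\<lambda>t. P t f x) \<longlongrightarrow> (\<integral>y. f y \<partial>\<pi>)) at_top" if f: "bcont f" for f x
  proof (rule Lim_transform_eventually)
    show "((\<lambda>t. \<integral>y. f y \<partial>(return borel x \<bind> K t)) \<longlongrightarrow> (\<integral>y. f y \<partial>\<pi>)) at_top"
      using conv[OF pr_return, of x] f by (auto simp: weak_conv_at_top_def bcont_def)
    show "eventually (\<lambda>t. (\<integral>y. f y \<partial>(return borel x \<bind> K t)) = P t f x) at_top"
      using eventually_ge_at_top[of 0] by eventually_elim (simp add: return_bind P_def)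
  qed
  with \<pi> show ?thesis by (intro that) (auto simp: invariant_measure_def)
qed

text \<open>The limit of \<open>P t f x\<close> is the same for all \<open>x\<close>, so the inner
  limsup vanishes at every \<open>x\<close>, near \<open>z\<close> or not.\<close>

lemma stable_imp_eventually_continuous_at:
  assumes "asymptotically_stable K"
  shows "eventually_continuous_at K z"
  unfolding eventually_continuous_at_def
proof (intro allI impI)
  fix f :: "'a \<Rightarrow> real" assume "(\<exists>L. L-lipschitz_on UNIV f) \<and> bounded (range f)"
  then have f: "bcont f"
    by (intro bounded_lipschitz_bcont) (simp add: bounded_lipschitz_def)
  obtain \<pi> where \<pi>: "\<And>x. ((\<lambda>t. P t f x) \<longlongrightarrow> (\<integral>y. f y \<partial>\<pi>)) at_top"
    using stable_P_tendsto[OF assms] f by metis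
  have "Limsup at_top (\<lambda>t. ereal \<bar>P t f x - P t f z\<bar>) = 0" for x
  proof -
    have "((\<lambda>t. ereal \<bar>P t f x - P t f z\<bar>) \<longlongrightarrow> ereal \<bar>(\<integral>y. f y \<partial>\<pi>) - (\<integral>y. f y \<partial>\<pi>)\<bar>) at_top"
      by (intro tendsto_intros \<pi>)
    then show ?thesis by (intro lim_imp_Limsup) (auto simp: zero_ereal_def)
  qed
  then show "Limsup (nhds z) (\<lambda>x. Limsup at_top
      (\<lambda>t. ereal \<bar>(\<integral>y. f y \<partial>K t x) - (\<integral>y. f y \<partial>K t z)\<bar>)) = 0"
    by (simp add: P_def Limsup_const)
qed

text \<open>Any point of the support of the limit law can serve as \<open>z\<close>. As the limit
  does not depend on the starting point, a continuous minorant of the indicator of the ball yields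
  one bound for all \<open>x\<close>; halving its integral turns the limit into an eventual
  inequality.\<close>

lemma stable_imp_lower_bound_cond:
  assumes "asymptotically_stable K"
  shows "\<exists>z. lower_bound_cond K z"
proof -
  obtain \<pi> where pr\<pi>: "pr \<pi>"
    and \<pi>: "\<And>f x. bcont f \<Longrightarrow> ((\<lambda>t. P t f x) \<longlongrightarrow> (\<integral>y. f y \<partial>\<pi>)) at_top"
    using stable_P_tendsto[OF assms] by metis
  note p\<pi> = prob_algebraD(1,2)[OF pr\<pi>]
  have "measure \<pi> (joint_support (\<lambda>_::unit. \<pi>)) = 1"
    by (rule measure_joint_support) (use p\<pi> in auto)
  then have "joint_support (\<lambda>_::unit. \<pi>) \<noteq> {}" by auto
  then obtain z where z: "\<And>r. r > 0 \<Longrightarrow> measure \<pi> (ball z r) > 0"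
    by (auto simp: joint_support_def)
  have "0 < (INF x. Liminf at_top (\<lambda>t. ereal (measure (K t x) (ball z e))))" if e: "e > 0" for e
  proof -
    obtain n where n: "(\<integral>x. open_bump (ball z e) n x \<partial>\<pi>) > 0"
      by (rule open_bump_integral_pos[OF p\<pi> open_ball z[OF e]])
    define c where "c = (\<integral>x. open_bump (ball z e) n x \<partial>\<pi>)"
    have "ereal (c / 2) \<le> Liminf at_top (\<lambda>t. ereal (measure (K t x) (ball z e)))" for x
    proof (rule Liminf_bounded)
      have "eventually (\<lambda>t. c / 2 < P t (open_bump (ball z e) n) x) at_top"
        using n by (intro order_tendstoD(1)[OF \<pi>[OF bcont_open_bump]]) (simp add: c_def)
      then show "eventually (\<lambda>t. ereal (c / 2) \<le> ereal (measure (K t x) (ball z e))) at_top"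
        using eventually_ge_at_top[of 0]
      proof eventually_elim
        case (elim t)
        have "P t (open_bump (ball z e) n) x \<le> measure (K t x) (ball z e)"
          unfolding P_def using prob_algebraD[OF pr_kernel[OF elim(2)]]
          by (intro open_bump_integral_le) auto
        then show ?case using elim(1) by simp
      qed
    qed
    then have "ereal (c / 2) \<le> (INF x. Liminf at_top (\<lambda>t. ereal (measure (K t x) (ball z e))))"
      by (intro INF_greatest)
    moreover have "0 < ereal (c / 2)" using n by (simp add: c_def)
    ultimately show ?thesis by (rule less_le_trans[rotated])
  qed
  then show ?thesis by (auto simp: lower_bound_cond_def)
qed

end

theorem theorem3p16:
  fixes K :: "real \<Rightarrow> 'a::polish_space \<Rightarrow> 'a measure"
  assumes "markov_feller_semigroup K"
  shows "(asymptotically_stable K \<longleftrightarrow>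
            ((\<forall>z. eventually_continuous_at K z) \<and> (\<exists>z. lower_bound_cond K z)))
       \<and> (asymptotically_stable K \<longleftrightarrow>
            (\<exists>z. eventually_continuous_at K z \<and> lower_bound_cond K z))"
proof -
  interpret markov_feller K by unfold_locales (rule assms)
  \<comment> \<open>This is (iii) implies (i). Condition (ii) gives (iii) at the point of its lower
    bound, and (i) gives (ii) by the two preceding lemmas.\<close>
  have "asymptotically_stable K" if "eventually_continuous_at K z" "lower_bound_cond K z" for z
  proof -
    interpret eventually_continuous_semigroup K z by unfold_locales (use that in auto)
    show ?thesis by (rule asymptotically_stable)
  qed
  then show ?thesis
    using stable_imp_eventually_continuous_at stable_imp_lower_bound_cond by blast
qed

end
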